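(* Assume that $g:\mathbb{R}\to(0,+\infty)$ is non-decreasing and continuous, and that $q\ge0$, $\theta>0$, $C>0$ and $\tau$ are constants with $\theta q<\tau<\theta q+1$. Consider the Cauchy problem $$v'(r)=C\,r^{-q}\left(\int_0^r s^{\tau-1}g(v(s))\,ds\right)^{\frac1\theta}\quad (r\in(0,+\infty)),\qquad v(0)=a. \tag{P}$$ (a) If $g$ satisfies $$\int^{+\infty}\left(\int_0^t g^{\kappa}(s)\,ds\right)^{-\frac{1}{\kappa\theta+1}}dt=+\infty,$$ where $\kappa=\frac{1-\epsilon}{\tau-\theta q-\epsilon}$ for some constant $\epsilon\in(0,\tau-\theta q)$, then (P) has a solution $v\in C^1[0,+\infty)\cap C^2(0,+\infty)$ with $v'(0)=0$, and $v'(r)>0$, $v''(r)>0$ for $r\in(0,+\infty)$, for some initial value $a$. Moreover, the following properties hold: (i) If $\tau>\theta(q+1)$, then $v\in C^2[0,+\infty)$ with $v''(0)=0$. (ii) If $\tau=\theta(q+1)$, then $v\in C^2[0,+\infty)$ with $v''(0)=C\left(\frac{g(a)}{\tau}\right)^{\frac1\theta}$. (iii) If $\tau<\theta(q+1)$, then $v\in C^2(0,+\infty)\cap W^{2,\delta}_{loc}(0,+\infty)$, where $\delta\in\left(1,\frac{\theta}{\theta(q+1)-\tau}\right)$. (b) If (P) has a solution $v\in C^1[0,+\infty)\cap C^2(0,+\infty)$ satisfying the properties in cases (i), (ii) or (iii) of (a), with $v'(0)=0$, and $v'(r)>0$, $v''(r)>0$ for $r\in(0,+\infty)$, for some initial value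 $a$, then $$\int^{+\infty}\left(\int_0^t g(s)\,ds\right)^{-\frac{1}{\theta+1}}dt=+\infty .$$
   Context: In an integral written $\int^{+\infty}$ the lower limit is omitted; it may be any positive number. $g^\kappa(s)$ means $(g(s))^\kappa$. $W^{2,\delta}_{loc}$ denotes the usual local Sobolev space. *)

theory Defs
  imports "HOL-Analysis.Analysis"
begin

section \<open>Functions of class C^k and local Sobolev spaces on the line\<close>

text \<open>The derivative relative to \<open>S\<close>; at an endpoint of an interval \<open>S\<close> it is one-sided.\<close>

definition deriv_on :: "real set \<Rightarrow> (real \<Rightarrow> real) \<Rightarrow> real \<Rightarrow> real" where
  "deriv_on S f x = vector_derivative f (at x within S)"

text \<open>Membership in \<open>C^k(S)\<close>, for \<open>S\<close> a nondegenerate interval. On \<open>{0..}\<close> the derivatives up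
  to order \<open>k\<close> exist and are continuous up to and including \<open>0\<close>, where they are one-sided.
  Values of \<open>f\<close> outside \<open>S\<close> play no role.\<close>

primrec Ck_on :: "nat \<Rightarrow> real set \<Rightarrow> (real \<Rightarrow> real) \<Rightarrow> bool" where
  "Ck_on 0 S f \<longleftrightarrow> continuous_on S f"
| "Ck_on (Suc k) S f \<longleftrightarrow> f differentiable_on S \<and> Ck_on k S (deriv_on S f)"

definition test_function :: "real set \<Rightarrow> (real \<Rightarrow> real) \<Rightarrow> bool" where
  "test_function S \<phi> \<longleftrightarrow>
     (\<forall>n. Ck_on n UNIV \<phi>) \<and> compact (closure {x. \<phi> x \<noteq> 0}) \<and> closure {x. \<phi> x \<noteq> 0} \<subseteq> S"

definition Lp_loc :: "real \<Rightarrow> real set \<Rightarrow> (real \<Rightarrow> real) \<Rightarrow> bool" where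
  "Lp_loc p S u \<longleftrightarrow> set_borel_measurable lebesgue S u \<and>
     (\<forall>K. compact K \<and> K \<subseteq> S \<longrightarrow> set_integrable lebesgue K (\<lambda>x. \<bar>u x\<bar> powr p))"

definition weak_deriv :: "nat \<Rightarrow> real set \<Rightarrow> (real \<Rightarrow> real) \<Rightarrow> (real \<Rightarrow> real) \<Rightarrow> bool" where
  "weak_deriv j S u w \<longleftrightarrow>
     (\<forall>\<phi>. test_function S \<phi> \<longrightarrow>
        (LINT x:S|lebesgue. u x * (deriv ^^ j) \<phi> x) = (-1) ^ j * (LINT x:S|lebesgue. w x * \<phi> x))"

text \<open>\<open>W^{k,p}_loc(S)\<close> for open \<open>S\<close> and \<open>1 \<le> p < \<infinity>\<close>: as usual, integrability is required on compact
  subsets of the open set \<open>S\<close> only.\<close>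

definition Sobolev_loc :: "nat \<Rightarrow> real \<Rightarrow> real set \<Rightarrow> (real \<Rightarrow> real) \<Rightarrow> bool" where
  "Sobolev_loc k p S u \<longleftrightarrow>
     Lp_loc p S u \<and> (\<forall>j\<in>{1..k}. \<exists>w. Lp_loc p S w \<and> weak_deriv j S u w)"


section \<open>The Cauchy problem\<close>

text \<open>Only the values of \<open>v\<close> on \<open>{0..}\<close> matter. For \<open>\<tau> > 0\<close> and \<open>v\<close> continuous on \<open>{0..}\<close> the
  integrand below is integrable on \<open>{0..r}\<close>, so the integral is not a default value; at \<open>s = 0\<close>
  the convention \<open>0 powr x = 0\<close> affects a single point.\<close>

definition solves_P ::
  "(real \<Rightarrow> real) \<Rightarrow> real \<Rightarrow> real \<Rightarrow> real \<Rightarrow> real \<Rightarrow> real \<Rightarrow> (real \<Rightarrow> real) \<Rightarrow> bool" where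
  "solves_P g q \<theta> C \<tau> a v \<longleftrightarrow>
     (\<forall>r>0. (v has_real_derivative
               C * r powr (-q) * (integral {0..r} (\<lambda>s. s powr (\<tau> - 1) * g (v s))) powr (1 / \<theta>))
             (at r))
     \<and> v 0 = a"

abbreviation D1 :: "(real \<Rightarrow> real) \<Rightarrow> real \<Rightarrow> real" where
  "D1 v \<equiv> deriv_on {0..} v"

abbreviation D2 :: "(real \<Rightarrow> real) \<Rightarrow> real \<Rightarrow> real" where
  "D2 v \<equiv> deriv_on {0..} (deriv_on {0..} v)"

definition convex_solution ::
  "(real \<Rightarrow> real) \<Rightarrow> real \<Rightarrow> real \<Rightarrow> real \<Rightarrow> real \<Rightarrow> real \<Rightarrow> (real \<Rightarrow> real) \<Rightarrow> bool" where
  "convex_solution g q \<theta> C \<tau> a v \<longleftrightarrow>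
     solves_P g q \<theta> C \<tau> a v \<and> Ck_on 1 {0..} v \<and> Ck_on 2 {0<..} v \<and>
     D1 v 0 = 0 \<and> (\<forall>r>0. D1 v r > 0 \<and> D2 v r > 0)"

definition regularity ::
  "(real \<Rightarrow> real) \<Rightarrow> real \<Rightarrow> real \<Rightarrow> real \<Rightarrow> real \<Rightarrow> real \<Rightarrow> (real \<Rightarrow> real) \<Rightarrow> bool" where
  "regularity g q \<theta> C \<tau> a v \<longleftrightarrow>
     (\<tau> > \<theta> * (q + 1) \<longrightarrow> Ck_on 2 {0..} v \<and> D2 v 0 = 0) \<and>
     (\<tau> = \<theta> * (q + 1) \<longrightarrow> Ck_on 2 {0..} v \<and> D2 v 0 = C * (g a / \<tau>) powr (1 / \<theta>)) \<and>
     (\<tau> < \<theta> * (q + 1) \<longrightarrow> Ck_on 2 {0<..} v \<and>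
        (\<forall>\<delta>. 1 < \<delta> \<and> \<delta> < \<theta> / (\<theta> * (q + 1) - \<tau>) \<longrightarrow> Sobolev_loc 2 \<delta> {0<..} v))"

end

theory Submission
  imports Defs
begin

text \<open>For a solution \<open>v\<close> put \<open>h(s) = g(v(s))\<close> and \<open>I(r) = \<integral>\<^sub>0\<^sup>r s\<^bsup>\<tau>-1\<^esup> h(s) ds\<close>, so that
  \<open>v' = C r\<^bsup>-q\<^esup> I\<^bsup>1/\<theta>\<^esup>\<close>. In the file \<open>I\<close> is \<open>moment h\<close> and \<open>v'\<close> is \<open>speed h\<close>.

  \<^bold>\<open>Regularity.\<close> Everything can be read off the quotient \<open>I(r) / r\<^sup>\<tau>\<close>. It tends to \<open>h(0) / \<tau>\<close>
  at the origin, which gives the behaviour of \<open>v'\<close> and \<open>v''\<close> there, and it is at most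
  \<open>h(r) / \<tau>\<close> because \<open>h\<close> is non-decreasing. Since \<open>v''\<close> is a positive multiple of
  \<open>h(r) / \<theta> - q I(r) / r\<^sup>\<tau>\<close> and \<open>\<theta> q < \<tau>\<close>, the solution is strictly convex. The local Sobolev space
  on the open half-line sees compact subsets only, where \<open>v\<close> is of class \<open>C\<^sup>2\<close>.

  \<^bold>\<open>Existence.\<close> The integral operator behind the problem is monotone because \<open>g\<close> is. Starting from
  a constant, its iterates (\<open>picard\<close>) therefore increase, they are defined on the whole half-line,
  and each of them satisfies the differential inequality \<open>u' \<le> speed (g \<circ> u)\<close>. It remains to bound
  all such \<open>u\<close> on a bounded interval \<open>[0,R]\<close> by one constant (\<open>a_priori_bound\<close>); then the limit of the
  iterates is a solution by dominated convergence. Hoelder's inequality with exponent \<open>\<kappa>\<close> moves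
  the weight out of the integral, \<open>u' \<le> K J\<^bsup>1/(\<kappa>\<theta>)\<^esup>\<close> with \<open>J(r) = \<integral>\<^sub>0\<^sup>r g(u)\<^sup>\<kappa>\<close>; the power of \<open>r\<close> that
  is left over is nonnegative exactly because \<open>\<kappa> (\<tau> - \<theta> q) \<ge> 1\<close>. The function \<open>y\<close> with
  \<open>y' = K J\<^bsup>1/(\<kappa>\<theta>)\<^esup>\<close> and \<open>y(0) = u(0)\<close> dominates \<open>u\<close>, and \<open>y' J' = y' g(u)\<^sup>\<kappa> \<le> y' g(y)\<^sup>\<kappa>\<close> integrates
  to an energy inequality, \<open>y' \<le> const \<cdot> G(y)\<^bsup>1/(\<kappa>\<theta>+1)\<^esup>\<close> with \<open>G(t) = \<integral>\<^sub>0\<^sup>t g\<^sup>\<kappa>\<close>. Separating the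
  variables bounds \<open>\<integral> G\<^bsup>-1/(\<kappa>\<theta>+1)\<^esup>\<close> over \<open>[y(0), y(r)]\<close> by a multiple of \<open>R\<close>; as this integral
  diverges at infinity, \<open>y(r)\<close> is bounded.

  \<^bold>\<open>Necessity.\<close> The energy inequality is now needed in the other direction. By convexity
  \<open>\<integral> g\<close> over \<open>[v(0), v(r)]\<close> equals \<open>\<integral>\<^sub>0\<^sup>r g(v) v' \<le> v'(r) \<integral>\<^sub>0\<^sup>r g(v)\<close>, and the last integral is at most
  \<open>max 1 \<tau> \<cdot> r\<^bsup>1-\<tau>\<^esup> I(r)\<close> (\<open>mean_le_moment\<close>). Expressing \<open>I\<close> through \<open>v'\<close> one finds
  \<open>G(v) \<le> const \<cdot> (r v')\<^bsup>\<theta>+1\<^esup>\<close> for large \<open>r\<close>, where now \<open>G(t) = \<integral>\<^sub>0\<^sup>t g\<close>. Hence the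
  \<open>r\<close>-derivative of \<open>\<integral> G\<^bsup>-1/(\<theta>+1)\<^esup>\<close> over \<open>[c, v(r)]\<close> is at least \<open>const / r\<close>, and the logarithm
  diverges.\<close>

section \<open>Tools for one-dimensional integrals\<close>

lemma at_within_atLeast_atMost:
  fixes a r b :: real
  assumes "a \<le> r" "r < b"
  shows "at r within {a..} = at r within {a..b}"
  by (rule at_within_nhd[of _ "{..<b}"]) (use assms in auto)

text \<open>At the endpoint \<open>r = a\<close> the derivative is one-sided. Continuity is required at \<open>r\<close> only, since the
  integrand \<open>s powr (\<tau> - 1) * h s\<close> below may be unbounded near \<open>0\<close>.\<close>

lemma integral_from_derivative:
  fixes f :: "real \<Rightarrow> real"
  assumes int: "\<And>b. f integrable_on {a..b}" and "a \<le> r" and cont: "continuous (at r within {a..}) f"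
  shows "((\<lambda>t. integral {a..t} f) has_real_derivative f r) (at r within {a..})"
proof -
  have eq: "at r within {a..} = at r within {a..r+1}"
    using \<open>a \<le> r\<close> by (intro at_within_atLeast_atMost) auto
  have "((\<lambda>t. integral {a..t} f) has_vector_derivative f r) (at r within ({a..r+1} - {}))"
    by (rule integral_has_vector_derivative_continuous_at[OF int])
       (use \<open>a \<le> r\<close> cont eq in auto)
  then show ?thesis
    by (simp add: eq has_real_derivative_iff_has_vector_derivative)
qed

lemma integral_from_derivative_at:
  fixes f :: "real \<Rightarrow> real"
  assumes int: "\<And>b. f integrable_on {a..b}" and "a < r" and cont: "continuous (at r) f"
  shows "((\<lambda>t. integral {a..t} f) has_real_derivative f r) (at r)"
proof -
  have "at r within {a..} = at r"
    using \<open>a < r\<close> by (intro at_within_interior) simp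
  then show ?thesis
    using integral_from_derivative[OF int, of r] assms by simp
qed

lemma integral_from_continuous:
  fixes f :: "real \<Rightarrow> real"
  assumes int: "\<And>b. f integrable_on {a..b}"
  shows "continuous_on {a..} (\<lambda>t. integral {a..t} f)"
  unfolding continuous_on_eq_continuous_within
proof
  fix r assume "r \<in> {a..}"
  then have eq: "at r within {a..} = at r within {a..r+1}"
    by (intro at_within_atLeast_atMost) auto
  have "continuous_on {a..r+1} (\<lambda>t. integral {a..t} f)"
    by (rule indefinite_integral_continuous_1[OF int])
  then show "continuous (at r within {a..}) (\<lambda>t. integral {a..t} f)"
    unfolding eq using \<open>r \<in> {a..}\<close> by (simp add: continuous_on_eq_continuous_within)
qed

lemma continuous_on_atLeast_integrable:
  fixes f :: "real \<Rightarrow> real"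
  assumes "continuous_on {a..} f"
  shows "f integrable_on {a..b}"
  by (rule integrable_continuous_real) (rule continuous_on_subset[OF assms], auto)

lemma continuous_on_atLeast_at:
  fixes f :: "real \<Rightarrow> real"
  assumes "continuous_on {a..} f" "a < r"
  shows "continuous (at r) f"
  using assms continuous_on_interior[of "{a..}" f r] by simp

lemma continuous_on_atLeast_right_limit:
  fixes f :: "real \<Rightarrow> real"
  assumes "continuous_on {a..} f"
  shows "(f \<longlongrightarrow> f a) (at_right a)"
  using bspec[OF assms[unfolded continuous_on], of a] by (simp add: at_within_Ici_at_right)

lemma integral_ge_initial_value:
  fixes k :: "real \<Rightarrow> real"
  assumes "k integrable_on {0..t}" and "\<And>s. 0 \<le> s \<Longrightarrow> k 0 \<le> k s" and "0 \<le> t"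
  shows "t * k 0 \<le> integral {0..t} k"
proof -
  have "integral {0..t} (\<lambda>_. k 0) \<le> integral {0..t} k"
    by (rule integral_le) (use assms in auto)
  with \<open>0 \<le> t\<close> show ?thesis by simp
qed

lemma integral_difference:
  fixes f :: "real \<Rightarrow> real"
  assumes f: "continuous_on {a..} f" and "a \<le> x" "x \<le> y"
  shows "integral {a..y} f - integral {a..x} f = integral {x..y} f"
  using Henstock_Kurzweil_Integration.integral_combine[of a x y f] continuous_on_atLeast_integrable[OF f] assms by simp

text \<open>The divergence condition refers to a nonnegative Lebesgue integral; this translates it into
  unboundedness of the primitive. Freezing the integrand to the left of \<open>c\<close> makes it continuous on
  the whole line, as the fundamental theorem for half-lines expects.\<close>

lemma nn_integral_atLeast_eq_infinity_iff:
  fixes f :: "real \<Rightarrow> real"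
  assumes f: "continuous_on {c..} f" and nonneg: "\<And>x. c \<le> x \<Longrightarrow> 0 \<le> f x"
  shows "(\<integral>\<^sup>+ t\<in>{c..}. ennreal (f t) \<partial>lborel) = \<infinity> \<longleftrightarrow> (\<forall>B. \<exists>T\<ge>c. B < integral {c..T} f)"
    (is "?N = \<infinity> \<longleftrightarrow> _")
proof -
  define g where "g = (\<lambda>x. f (max c x))"
  have g: "continuous_on UNIV g"
    unfolding g_def by (rule continuous_on_compose2[OF f]) (auto intro!: continuous_intros)
  have gi: "g integrable_on {a..b}" for a b
    by (rule integrable_continuous_real) (rule continuous_on_subset[OF g], auto)
  have gpos: "0 \<le> g x" for x
    unfolding g_def by (rule nonneg) simp
  define F where "F = (\<lambda>T. integral {c-1..T} g)"
  have F: "(F has_real_derivative g x) (at x)" if "c \<le> x" for x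
    unfolding F_def using that g
    by (intro integral_from_derivative_at gi) (auto simp: continuous_on_eq_continuous_at)
  have Fint: "F T - F c = integral {c..T} f" if "c \<le> T" for T
  proof -
    have "F T - F c = integral {c..T} g"
      unfolding F_def
      by (rule integral_difference) (use that g continuous_on_subset in auto)
    also have "\<dots> = integral {c..T} f"
      by (rule integral_cong) (auto simp: g_def max_def)
    finally show ?thesis .
  qed
  have Fmono: "F x \<le> F y" if "c \<le> x" "x \<le> y" for x y
    by (rule DERIV_nonneg_imp_nondecreasing[OF \<open>x \<le> y\<close>]) (use F gpos that in \<open>meson order_trans\<close>)
  have gb: "g \<in> borel_measurable borel"
    using g by (rule borel_measurable_continuous_onI)
  have N: "?N = (\<integral>\<^sup>+ t. ennreal (g t) * indicator {c..} t \<partial>lborel)"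
    by (rule nn_integral_cong) (auto simp: g_def max_def indicator_def)
  show ?thesis
  proof
    assume inf: "?N = \<infinity>"
    show "\<forall>B. \<exists>T\<ge>c. B < integral {c..T} f"
    proof (rule ccontr)
      assume "\<not> ?thesis"
      then obtain B where "\<And>T. T \<ge> c \<Longrightarrow> integral {c..T} f \<le> B"
        by (meson not_less)
      then have B: "F T \<le> B + F c" if "T \<ge> c" for T
        using Fint[OF that] that by (metis diff_le_eq)
      define L where "L = (SUP T\<in>{c..}. F T)"
      have bdd: "bdd_above (F ` {c..})"
        by (rule bdd_aboveI2[of _ _ "B + F c"]) (use B in auto)
      have "(F \<longlongrightarrow> L) at_top"
      proof (rule increasing_tendsto)
        show "eventually (\<lambda>T. F T \<le> L) at_top"
          using eventually_ge_at_top[of c]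
          by eventually_elim (auto simp: L_def intro: cSUP_upper bdd)
        fix l assume "l < L"
        then obtain T0 where "T0 \<ge> c" "l < F T0"
          unfolding L_def using less_cSUP_iff[OF _ bdd] by auto
        then show "eventually (\<lambda>T. l < F T) at_top"
          unfolding eventually_at_top_linorder by (meson Fmono less_le_trans)
      qed
      from nn_integral_FTC_atLeast[OF gb F gpos this] inf N show False
        by simp
    qed
  next
    assume unb: "\<forall>B. \<exists>T\<ge>c. B < integral {c..T} f"
    have "ennreal B \<le> ?N" for B
    proof -
      obtain T where T: "T \<ge> c" "B < F T - F c"
        using unb Fint by metis
      have "ennreal B \<le> ennreal (F T - F c)"
        using T by (intro ennreal_leI) simp
      also have "\<dots> = (\<integral>\<^sup>+ t. ennreal (g t) * indicator {c..T} t \<partial>lborel)"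
        by (rule nn_integral_FTC_Icc[symmetric])
           (use T F gpos gb in \<open>auto intro: has_field_derivative_at_within
              simp flip: has_real_derivative_iff_has_vector_derivative\<close>)
      also have "\<dots> \<le> ?N"
        unfolding N by (rule nn_integral_mono) (auto simp: indicator_def)
      finally show ?thesis .
    qed
    then show "?N = \<infinity>"
      by (metis ennreal_Ex_less_of_nat ennreal_of_nat_eq_real_of_nat infinity_ennreal_def
          linorder_not_less top.not_eq_extremum)
  qed
qed

text \<open>Integrate Young's inequality for the two functions scaled to norm one.\<close>

lemma Hoelder_integral:
  fixes f h :: "real \<Rightarrow> real"
  assumes pq: "p > 1" "p' > 1" "1 / p + 1 / p' = 1"
    and nonneg: "\<And>x. x \<in> S \<Longrightarrow> 0 \<le> f x" "\<And>x. x \<in> S \<Longrightarrow> 0 \<le> h x"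
    and int: "(\<lambda>x. f x powr p) integrable_on S" "(\<lambda>x. h x powr p') integrable_on S"
      "(\<lambda>x. f x * h x) integrable_on S"
    and pos: "0 < integral S (\<lambda>x. f x powr p)" "0 < integral S (\<lambda>x. h x powr p')"
  shows "integral S (\<lambda>x. f x * h x)
      \<le> integral S (\<lambda>x. f x powr p) powr (1 / p) * integral S (\<lambda>x. h x powr p') powr (1 / p')"
proof -
  define A B where "A = integral S (\<lambda>x. f x powr p)" and "B = integral S (\<lambda>x. h x powr p')"
  define \<alpha> \<beta> where "\<alpha> = A powr (1 / p)" and "\<beta> = B powr (1 / p')"
  have AB: "A > 0" "B > 0" using pos by (simp_all add: A_def B_def)
  then have ab: "\<alpha> > 0" "\<beta> > 0" by (simp_all add: \<alpha>_def \<beta>_def)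
  have ap: "\<alpha> powr p = A" "\<beta> powr p' = B"
    using AB pq by (simp_all add: \<alpha>_def \<beta>_def powr_powr)
  have "integral S (\<lambda>x. f x * h x / (\<alpha> * \<beta>)) \<le> integral S (\<lambda>x. f x powr p / (A * p) + h x powr p' / (B * p'))"
  proof (rule integral_le)
    fix x assume "x \<in> S"
    then have "(f x / \<alpha>) * (h x / \<beta>) \<le> (f x / \<alpha>) powr p / p + (h x / \<beta>) powr p' / p'"
      using nonneg ab pq by (intro Youngs_inequality) auto
    then show "f x * h x / (\<alpha> * \<beta>) \<le> f x powr p / (A * p) + h x powr p' / (B * p')"
      using nonneg[OF \<open>x \<in> S\<close>] ab by (simp add: powr_divide ap)
  qed (intro integrable_add integrable_on_divide int)+
  also have "\<dots> = A / (A * p) + B / (B * p')"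
    by (subst Henstock_Kurzweil_Integration.integral_add)
       (auto intro!: integrable_on_divide int simp: A_def B_def)
  also have "\<dots> = 1"
    using AB pq by simp
  finally show ?thesis
    using ab by (simp add: \<alpha>_def \<beta>_def A_def B_def field_simps)
qed

section \<open>Regularity classes\<close>

lemma deriv_on_eq:
  assumes "(f has_real_derivative D) (at x within S)" and "at x within S \<noteq> bot"
  shows "deriv_on S f x = D"
  using assms vector_derivative_within
  by (simp add: deriv_on_def has_real_derivative_iff_has_vector_derivative)

lemma deriv_on_cong:
  assumes "\<And>x. x \<in> S \<Longrightarrow> f x = g x" and "x \<in> S"
  shows "deriv_on S f x = deriv_on S g x"
  unfolding deriv_on_def by (rule vector_derivative_cong_eq) (use assms in auto)

lemma Ck_on_cong:
  assumes "\<And>x. x \<in> S \<Longrightarrow> f x = g x"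
  shows "Ck_on k S f \<longleftrightarrow> Ck_on k S g"
  using assms
proof (induction k arbitrary: f g)
  case 0
  then show ?case by (simp cong: continuous_on_cong)
next
  case (Suc k)
  have "deriv_on S f x = deriv_on S g x" if "x \<in> S" for x
    using deriv_on_cong Suc.prems that by blast
  with Suc.IH have "Ck_on k S (deriv_on S f) = Ck_on k S (deriv_on S g)" by blast
  moreover have "f differentiable_on S \<longleftrightarrow> g differentiable_on S"
    unfolding differentiable_on_def using Suc.prems
    by (metis differentiable_transform_within zero_less_one)
  ultimately show ?case by simp
qed

lemma Ck_on_SucI:
  assumes f: "\<And>x. x \<in> S \<Longrightarrow> (f has_real_derivative f' x) (at x within S)"
    and S: "\<And>x. x \<in> S \<Longrightarrow> at x within S \<noteq> bot" and "Ck_on k S f'"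
  shows "Ck_on (Suc k) S f"
proof -
  have "Ck_on k S (deriv_on S f) \<longleftrightarrow> Ck_on k S f'"
    by (rule Ck_on_cong) (rule deriv_on_eq[OF f S])
  with assms show ?thesis
    by (auto simp: differentiable_on_def real_differentiable_def
        intro!: field_differentiable_imp_differentiable dest!: f simp: field_differentiable_def)
qed

lemma at_within_atLeast_ne_bot: "x \<in> {a..} \<Longrightarrow> at x within {a..} \<noteq> (bot :: real filter)"
  using at_within_atLeast_atMost[of a x "x + 1"]
  by (auto simp: trivial_limit_within)

lemma at_within_greaterThan: "x \<in> {a<..} \<Longrightarrow> at x within {a<..} = at (x::real)"
  by (rule at_within_open) auto


lemma Lp_loc_continuous:
  assumes u: "continuous_on S u" and "open S" and "p > 0"
  shows "Lp_loc p S u"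
  unfolding Lp_loc_def
proof (intro conjI allI impI)
  have "set_borel_measurable borel S u"
    unfolding set_borel_measurable_def
    by (rule borel_measurable_continuous_on_indicator) (use assms in auto)
  then show "set_borel_measurable lebesgue S u"
    unfolding set_borel_measurable_def by (simp add: measurable_completion)
  fix K assume K: "compact K \<and> K \<subseteq> S"
  then have "continuous_on K (\<lambda>x. \<bar>u x\<bar> powr p)"
    using u \<open>p > 0\<close> by (intro continuous_on_powr' continuous_intros) (auto elim: continuous_on_subset)
  with K have int: "integrable lborel (\<lambda>x. indicator K x *\<^sub>R (\<bar>u x\<bar> powr p))"
    by (intro borel_integrable_compact) auto
  then show "set_integrable lebesgue K (\<lambda>x. \<bar>u x\<bar> powr p)"
    unfolding set_integrable_def
    by (subst integrable_completion) (use borel_measurable_integrable in auto)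
qed

lemma set_lebesgue_integral_compact_support:
  fixes f :: "real \<Rightarrow> real"
  assumes f: "continuous_on {a..b} f" and sub: "{a..b} \<subseteq> S" and zero: "\<And>x. x \<notin> {a..b} \<Longrightarrow> f x = 0"
  shows "(LINT x:S|lebesgue. f x) = integral {a..b} f"
proof -
  have "integrable lborel (\<lambda>x. indicator {a..b} x *\<^sub>R f x)"
    using f by (intro borel_integrable_compact) auto
  then have "f absolutely_integrable_on {a..b}"
    unfolding set_integrable_def
    by (subst integrable_completion) (use borel_measurable_integrable in auto)
  then have "(LINT x:{a..b}|lebesgue. f x) = integral {a..b} f"
    by (rule set_lebesgue_integral_eq_integral)
  moreover have "(LINT x:S|lebesgue. f x) = (LINT x:{a..b}|lebesgue. f x)"
    unfolding set_lebesgue_integral_def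
    by (rule Bochner_Integration.integral_cong) (use sub zero in \<open>auto simp: indicator_def\<close>)
  ultimately show ?thesis by simp
qed

text \<open>The function \<open>\<psi>\<close> is only required to be of class \<open>C\<^sup>1\<close>, so that the lemma applies to a test function
  and to its derivative alike.\<close>

lemma integration_by_parts_compact_support:
  fixes u u' \<psi> \<psi>' :: "real \<Rightarrow> real"
  assumes u: "\<And>x. x \<in> S \<Longrightarrow> (u has_real_derivative u' x) (at x)" "continuous_on S u'"
    and \<psi>: "\<And>x. (\<psi> has_real_derivative \<psi>' x) (at x)" "continuous_on UNIV \<psi>'"
    and sub: "{a..b} \<subseteq> S" and "a < b" and zero: "\<And>x. x \<notin> {a<..<b} \<Longrightarrow> \<psi> x = 0"
  shows "(LINT x:S|lebesgue. u x * \<psi>' x) = - (LINT x:S|lebesgue. u' x * \<psi> x)"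
proof -
  have zero': "\<psi>' x = 0" if "x \<notin> {a..b}" for x
  proof -
    have "(\<psi> has_real_derivative 0) (at x)"
      by (rule has_field_derivative_transform_within_open[where f = "\<lambda>_. 0" and S = "- {a..b}"])
         (use that zero in auto)
    with \<psi>(1) show ?thesis by (rule DERIV_unique)
  qed
  have cu: "continuous_on {a..b} u"
    using u(1) sub by (meson DERIV_isCont continuous_at_imp_continuous_on subsetD)
  have cu': "continuous_on {a..b} u'"
    using u(2) sub by (rule continuous_on_subset)
  have c\<psi>: "continuous_on {a..b} \<psi>"
    using \<psi>(1) by (meson DERIV_isCont continuous_at_imp_continuous_on)
  have c\<psi>': "continuous_on {a..b} \<psi>'"
    using \<psi>(2) by (rule continuous_on_subset) simp
  have "((\<lambda>x. \<psi>' x * u x) has_integral (- integral {a..b} (\<lambda>x. \<psi> x * u' x))) {a..b}"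
  proof (rule integration_by_parts[OF bounded_bilinear_mult _ c\<psi> cu])
    have "((\<lambda>x. \<psi> x * u' x) has_integral integral {a..b} (\<lambda>x. \<psi> x * u' x)) {a..b}"
      using c\<psi> cu' by (intro integrable_integral integrable_continuous_real continuous_intros)
    then show "((\<lambda>x. \<psi> x * u' x) has_integral
        \<psi> b * u b - \<psi> a * u a - - integral {a..b} (\<lambda>x. \<psi> x * u' x)) {a..b}"
      using zero[of a] zero[of b] by simp
  qed (use \<open>a < b\<close> u(1) \<psi>(1) sub in \<open>auto simp flip: has_real_derivative_iff_has_vector_derivative\<close>)
  then have "integral {a..b} (\<lambda>x. u x * \<psi>' x) = - integral {a..b} (\<lambda>x. u' x * \<psi> x)"
    by (simp add: integral_unique mult.commute)
  then show ?thesis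
    by (subst (1 2) set_lebesgue_integral_compact_support[where a = a and b = b])
       (use zero zero' cu cu' c\<psi> c\<psi>' sub in \<open>auto intro!: continuous_intros\<close>)
qed

text \<open>A compact subset of the open half-line stays away from the origin.\<close>

lemma test_function_support:
  assumes "test_function {0<..} \<phi>"
  obtains a b where "0 < a" "a < b" "\<And>x. x \<notin> {a<..<b} \<Longrightarrow> \<phi> x = 0"
proof -
  let ?K = "closure {x. \<phi> x \<noteq> 0}"
  have K: "compact ?K" "?K \<subseteq> {0<..}"
    using assms by (auto simp: test_function_def)
  have supp: "\<phi> x = 0" if "x \<notin> ?K" for x
    using that closure_subset[of "{x. \<phi> x \<noteq> 0}"] by auto
  show thesis
  proof (cases "?K = {}")
    case True
    then have "\<phi> x = 0" for x using supp by blast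
    then show thesis by (intro that[of 1 2]) simp_all
  next
    case False
    obtain m where m: "m \<in> ?K" "\<And>x. x \<in> ?K \<Longrightarrow> m \<le> x"
      using compact_attains_inf[OF K(1) False] by auto
    obtain M where M: "M \<in> ?K" "\<And>x. x \<in> ?K \<Longrightarrow> x \<le> M"
      using compact_attains_sup[OF K(1) False] by auto
    have "0 < m" using m K by auto
    moreover have "m \<le> M" using m M by auto
    moreover have "\<phi> x = 0" if "x \<notin> {m / 2<..<M + 1}" for x
    proof (rule supp, rule notI)
      assume "x \<in> ?K"
      then have "m \<le> x" "x \<le> M" using m M by auto
      with that \<open>0 < m\<close> show False by auto
    qed
    ultimately show thesis using that[of "m / 2" "M + 1"] by auto
  qed
qed

lemma Ck_on_UNIV_deriv:
  assumes "Ck_on (Suc k) UNIV \<phi>"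
  shows "(\<phi> has_real_derivative deriv \<phi> x) (at x)" and "Ck_on k UNIV (deriv \<phi>)"
proof -
  have "\<phi> differentiable (at x)" for x
    using assms by (simp add: differentiable_on_def)
  then show D: "(\<phi> has_real_derivative deriv \<phi> x) (at x)" for x
    by (simp add: real_differentiable_def DERIV_deriv_iff_real_differentiable)
  have "deriv_on UNIV \<phi> = deriv \<phi>"
    by (rule ext, rule deriv_on_eq) (use D in auto)
  with assms show "Ck_on k UNIV (deriv \<phi>)" by simp
qed

text \<open>Classical derivatives are weak derivatives, and continuous functions are locally bounded
  inside the open half-line; hence the singularity of the second derivative at the origin is
  invisible to this space.\<close>

lemma Sobolev_loc_C2:
  fixes u u' u'' :: "real \<Rightarrow> real"
  assumes u: "\<And>x. x > 0 \<Longrightarrow> (u has_real_derivative u' x) (at x)"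
    and u': "\<And>x. x > 0 \<Longrightarrow> (u' has_real_derivative u'' x) (at x)"
    and u'': "continuous_on {0<..} u''" and "p > 0"
  shows "Sobolev_loc 2 p {0<..} u"
proof -
  have cu: "continuous_on {0<..} u"
    using u by (meson DERIV_isCont continuous_at_imp_continuous_on greaterThan_iff)
  have cu': "continuous_on {0<..} u'"
    using u' by (meson DERIV_isCont continuous_at_imp_continuous_on greaterThan_iff)
  have Lp: "Lp_loc p {0<..} u" "Lp_loc p {0<..} u'" "Lp_loc p {0<..} u''"
    using cu cu' u'' \<open>p > 0\<close> by (auto intro: Lp_loc_continuous)
  have weak: "(LINT x:{0<..}|lebesgue. u x * (deriv ^^ 1) \<phi> x)
                = (-1) ^ 1 * (LINT x:{0<..}|lebesgue. u' x * \<phi> x) \<and>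
              (LINT x:{0<..}|lebesgue. u x * (deriv ^^ 2) \<phi> x)
                = (-1) ^ 2 * (LINT x:{0<..}|lebesgue. u'' x * \<phi> x)"
    if \<phi>: "test_function {0<..} \<phi>" for \<phi>
  proof -
    obtain a b where ab: "0 < a" "a < b" and zero: "\<And>x. x \<notin> {a<..<b} \<Longrightarrow> \<phi> x = 0"
      using test_function_support[OF \<phi>] by blast
    have C: "Ck_on n UNIV \<phi>" for n
      using \<phi> by (simp add: test_function_def)
    note D1 = Ck_on_UNIV_deriv[OF C[of "Suc (Suc 0)"]]
    note D2 = Ck_on_UNIV_deriv[OF D1(2)]
    have cont: "continuous_on UNIV (deriv \<phi>)" "continuous_on UNIV (deriv (deriv \<phi>))"
      using D1(2) D2 by (auto simp: differentiable_imp_continuous_on)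
    have wide: "\<phi> x = 0" if "x \<notin> {a / 2<..<b + 1}" for x
      by (rule zero) (use that ab in auto)
    have zero': "deriv \<phi> x = 0" if "x \<notin> {a / 2<..<b + 1}" for x
    proof -
      have "(\<phi> has_real_derivative 0) (at x)"
        by (rule has_field_derivative_transform_within_open[where f = "\<lambda>_. 0" and S = "- {a..b}"])
           (use that zero ab in auto)
      with D1(1) show ?thesis by (rule DERIV_unique)
    qed
    have sub: "{a / 2..b + 1} \<subseteq> {0<..}" and ab': "a / 2 < b + 1" using ab by auto
    have "(LINT x:{0<..}|lebesgue. u x * deriv \<phi> x) = - (LINT x:{0<..}|lebesgue. u' x * \<phi> x)"
      by (rule integration_by_parts_compact_support[OF _ cu' D1(1) cont(1) sub ab' wide])
         (use u in auto)
    moreover have "(LINT x:{0<..}|lebesgue. u x * deriv (deriv \<phi>) x)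
        = - (LINT x:{0<..}|lebesgue. u' x * deriv \<phi> x)"
      by (rule integration_by_parts_compact_support[OF _ cu' D2(1) cont(2) sub ab' zero'])
         (use u in auto)
    moreover have "(LINT x:{0<..}|lebesgue. u' x * deriv \<phi> x)
        = - (LINT x:{0<..}|lebesgue. u'' x * \<phi> x)"
      by (rule integration_by_parts_compact_support[OF _ u'' D1(1) cont(1) sub ab' wide])
         (use u' in auto)
    ultimately show ?thesis by (simp add: numeral_2_eq_2)
  qed
  have "\<exists>w. Lp_loc p {0<..} w \<and> weak_deriv j {0<..} u w" if "j \<in> {1..2}" for j
  proof -
    from that have "j = 1 \<or> j = 2" by auto
    then show ?thesis
      using Lp weak unfolding weak_deriv_def by blast
  qed
  with Lp(1) show ?thesis by (simp add: Sobolev_loc_def)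
qed

section \<open>The nonlocal right-hand side\<close>

locale radial_equation =
  fixes q \<theta> C \<tau> :: real
  assumes q_nonneg: "q \<ge> 0" and \<theta>_pos: "\<theta> > 0" and C_pos: "C > 0" and \<theta>q_less: "\<theta> * q < \<tau>"
begin

text \<open>For the problem itself the lemmas are applied with \<open>h s = g (v s)\<close>. Treating \<open>h\<close> as an arbitrary
  continuous function on the half-line lets them serve solutions and iterates alike.\<close>

definition moment :: "(real \<Rightarrow> real) \<Rightarrow> real \<Rightarrow> real" where
  "moment h r = integral {0..r} (\<lambda>s. s powr (\<tau> - 1) * h s)"

text \<open>Since \<open>0 powr x = 0\<close>, this is \<open>0\<close> at the origin, which is the limit from the right
  (\<open>speed_continuous\<close>).\<close>

definition speed :: "(real \<Rightarrow> real) \<Rightarrow> real \<Rightarrow> real" where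
  "speed h r = C * r powr (-q) * moment h r powr (1 / \<theta>)"

lemma \<tau>_pos: "\<tau> > 0"
  using q_nonneg \<theta>_pos \<theta>q_less by (smt (verit) mult_nonneg_nonneg)

lemma exponent_pos: "\<tau> / \<theta> - q > 0"
  using \<theta>_pos \<theta>q_less by (simp add: field_simps)

lemma weighted_integrable:
  assumes h: "continuous_on {0..} h"
  shows "(\<lambda>s. s powr (\<tau> - 1) * h s) integrable_on {0..b}"
proof -
  have hc: "continuous_on {0..b} h"
    by (rule continuous_on_subset[OF h]) auto
  have "(\<lambda>s. s powr (\<tau> - 1)) integrable_on {0..b}"
  proof (cases "b \<ge> 0")
    case True
    then show ?thesis
      using has_integral_powr_from_0[of "\<tau> - 1" b] \<tau>_pos by auto
  qed auto
  then have "(\<lambda>s. s powr (\<tau> - 1)) absolutely_integrable_on {0..b}"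
    by (intro nonnegative_absolutely_integrable_1) auto
  then have "(\<lambda>s. h s * s powr (\<tau> - 1)) absolutely_integrable_on {0..b}"
    by (intro absolutely_integrable_bounded_measurable_product_real
          continuous_imp_measurable_on_sets_lebesgue hc compact_imp_bounded compact_continuous_image)
       auto
  then show ?thesis
    by (simp add: absolutely_integrable_on_def mult.commute)
qed

lemma weight_integral: "0 \<le> r \<Longrightarrow> ((\<lambda>s. s powr (\<tau> - 1)) has_integral (r powr \<tau> / \<tau>)) {0..r}"
  using has_integral_powr_from_0[of "\<tau> - 1" r] \<tau>_pos by simp

lemma moment_derivative:
  assumes h: "continuous_on {0..} h" and "r > 0"
  shows "(moment h has_real_derivative r powr (\<tau> - 1) * h r) (at r)"
  unfolding moment_def[abs_def]
  by (rule integral_from_derivative_at[OF weighted_integrable[OF h] \<open>r > 0\<close>])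
     (use \<open>r > 0\<close> in \<open>auto intro!: continuous_intros continuous_on_atLeast_at[OF h]\<close>)

lemma moment_continuous: "continuous_on {0..} h \<Longrightarrow> continuous_on {0..} (moment h)"
  unfolding moment_def[abs_def] by (intro integral_from_continuous weighted_integrable)

lemma moment_0 [simp]: "moment h 0 = 0"
  by (simp add: moment_def)

lemma moment_mono:
  assumes "continuous_on {0..} h" "continuous_on {0..} k"
    and "\<And>s. 0 \<le> s \<Longrightarrow> s \<le> r \<Longrightarrow> h s \<le> k s"
  shows "moment h r \<le> moment k r"
  unfolding moment_def
  by (intro integral_le weighted_integrable assms mult_left_mono) (use assms in auto)

lemma moment_upper:
  assumes "continuous_on {0..} h" "\<And>s. 0 \<le> s \<Longrightarrow> s \<le> r \<Longrightarrow> h s \<le> M" "0 \<le> r"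
  shows "moment h r \<le> M * r powr \<tau> / \<tau>"
proof -
  have "moment h r \<le> moment (\<lambda>_. M) r"
    using assms by (intro moment_mono) auto
  also have "\<dots> = M * r powr \<tau> / \<tau>"
    using has_integral_mult_left[OF weight_integral[OF \<open>0 \<le> r\<close>], of M]
    unfolding moment_def by (intro integral_unique) (simp add: mult.commute)
  finally show ?thesis .
qed

lemma moment_pos:
  assumes h: "continuous_on {0..} h" and pos: "\<And>s. 0 \<le> s \<Longrightarrow> h s > 0" and "r > 0"
  shows "moment h r > 0"
proof -
  have "moment h 0 < moment h r"
  proof (rule DERIV_pos_imp_increasing_open[OF \<open>r > 0\<close>])
    fix s :: real assume "0 < s"
    then have "s powr (\<tau> - 1) * h s > 0" using pos by simp
    with moment_derivative[OF h \<open>0 < s\<close>]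
    show "\<exists>y. (moment h has_real_derivative y) (at s) \<and> 0 < y" by blast
  qed (rule continuous_on_subset[OF moment_continuous[OF h]], auto)
  then show ?thesis by simp
qed

text \<open>By l'Hospital's rule: the quotient of the derivatives is \<open>h r / \<tau>\<close>.\<close>

lemma moment_ratio_limit:
  assumes h: "continuous_on {0..} h"
  shows "((\<lambda>r. moment h r / r powr \<tau>) \<longlongrightarrow> h 0 / \<tau>) (at_right 0)"
proof (rule lhopital_right_0)
  have "(moment h \<longlongrightarrow> moment h 0) (at_right 0)"
    by (rule continuous_on_atLeast_right_limit[OF moment_continuous[OF h]])
  then show "(moment h \<longlongrightarrow> 0) (at_right 0)"
    by simp
  show "((\<lambda>r. r powr \<tau>) \<longlongrightarrow> 0) (at_right 0)"
    using \<tau>_pos by (auto intro!: tendsto_eq_intros simp: eventually_at_filter)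
  show "\<forall>\<^sub>F r in at_right 0. r powr \<tau> \<noteq> 0" "\<forall>\<^sub>F r in at_right 0. \<tau> * r powr (\<tau> - 1) \<noteq> 0"
    using \<tau>_pos by (auto simp: eventually_at_filter)
  show "\<forall>\<^sub>F r in at_right 0. (moment h has_real_derivative r powr (\<tau> - 1) * h r) (at r)"
    using moment_derivative[OF h] by (auto simp: eventually_at_filter)
  show "\<forall>\<^sub>F r in at_right 0. ((\<lambda>r. r powr \<tau>) has_real_derivative \<tau> * r powr (\<tau> - 1)) (at r)"
    by (auto simp: eventually_at_filter intro!: always_eventually has_real_derivative_powr)
  have "(h \<longlongrightarrow> h 0) (at_right 0)"
    by (rule continuous_on_atLeast_right_limit[OF h])
  then have "((\<lambda>r. h r / \<tau>) \<longlongrightarrow> h 0 / \<tau>) (at_right 0)"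
    using \<tau>_pos by (intro tendsto_intros) auto
  then show "((\<lambda>r. r powr (\<tau> - 1) * h r / (\<tau> * r powr (\<tau> - 1))) \<longlongrightarrow> h 0 / \<tau>) (at_right 0)"
    by (rule Lim_transform_eventually) (auto simp: eventually_at_filter)
qed

lemma speed_0 [simp]: "speed h 0 = 0"
  by (simp add: speed_def)

text \<open>Separates the power of \<open>r\<close> that governs the behaviour at the origin from a factor that has a
  positive limit there.\<close>

lemma speed_ratio:
  assumes h: "continuous_on {0..} h" and "\<And>s. 0 \<le> s \<Longrightarrow> h s > 0" and "r > 0"
  shows "speed h r = C * (moment h r / r powr \<tau>) powr (1 / \<theta>) * r powr (\<tau> / \<theta> - q)"
  using moment_pos[OF assms] \<open>r > 0\<close>
  by (simp add: speed_def powr_divide powr_powr powr_diff powr_minus field_simps)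

lemma speed_pos:
  assumes "continuous_on {0..} h" and "\<And>s. 0 \<le> s \<Longrightarrow> h s > 0" and "r > 0"
  shows "speed h r > 0"
  using moment_pos[OF assms] \<open>r > 0\<close> C_pos by (simp add: speed_def)

lemma moment_nonneg:
  assumes "continuous_on {0..} h" and "\<And>s. 0 \<le> s \<Longrightarrow> h s > 0"
  shows "moment h r \<ge> 0"
proof (cases "r > 0")
  case False
  then have "r \<le> 0" by simp
  then show ?thesis
    by (cases "r = 0") (auto simp: moment_def)
qed (use moment_pos[OF assms] in fastforce)

lemma speed_mono:
  assumes "continuous_on {0..} h" "continuous_on {0..} k"
    and pos: "\<And>s. 0 \<le> s \<Longrightarrow> h s > 0"
    and le: "\<And>s. 0 \<le> s \<Longrightarrow> s \<le> r \<Longrightarrow> h s \<le> k s"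
  shows "speed h r \<le> speed k r"
  unfolding speed_def
  using moment_mono[OF assms(1,2) le] moment_nonneg[OF assms(1) pos] C_pos \<theta>_pos
  by (intro mult_left_mono powr_mono2) auto

text \<open>The derivative of the speed, again factored into quantities whose behaviour at the origin is known.\<close>

definition slope :: "(real \<Rightarrow> real) \<Rightarrow> real \<Rightarrow> real" where
  "slope h r = C * (moment h r / r powr \<tau>) powr (1 / \<theta> - 1) * r powr (\<tau> / \<theta> - q - 1)
                 * (h r / \<theta> - q * (moment h r / r powr \<tau>))"

lemma speed_derivative:
  assumes h: "continuous_on {0..} h" and pos: "\<And>s. 0 \<le> s \<Longrightarrow> h s > 0" and "r > 0"
  shows "(speed h has_real_derivative slope h r) (at r)"
proof -
  define m where "m = moment h r"
  have "m > 0" unfolding m_def by (rule moment_pos[OF assms])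
  define X where "X = m powr (1 / \<theta> - 1)"
  define Y where "Y = r powr (\<tau> - q - 1)"
  have 1: "((\<lambda>r. r powr (-q)) has_real_derivative (-q) * r powr (-q - 1)) (at r)"
    by (rule has_real_derivative_powr[OF \<open>r > 0\<close>])
  have 2: "((\<lambda>r. moment h r powr (1 / \<theta>)) has_real_derivative
              (1 / \<theta>) * m powr (1 / \<theta> - 1) * (r powr (\<tau> - 1) * h r)) (at r)"
    unfolding m_def
    by (rule DERIV_chain2[OF has_real_derivative_powr moment_derivative[OF h \<open>r > 0\<close>]])
       (use \<open>m > 0\<close> m_def in simp)
  have deriv: "(speed h has_real_derivative
          C * ((-q) * r powr (-q - 1) * m powr (1 / \<theta>)
             + (1 / \<theta>) * m powr (1 / \<theta> - 1) * (r powr (\<tau> - 1) * h r) * r powr (-q))) (at r)"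
    unfolding speed_def[abs_def] mult.assoc
    using DERIV_cmult[OF DERIV_mult[OF 1 2], of C] by (simp add: m_def mult.assoc)
  have "m powr (1 / \<theta>) = X * m"
    using \<open>m > 0\<close> by (simp add: X_def powr_diff)
  moreover have "r powr (-q - 1) = Y / r powr \<tau>"
    using \<open>r > 0\<close> by (simp add: Y_def flip: powr_diff)
  moreover have "r powr (-q) * r powr (\<tau> - 1) = Y"
    by (simp add: Y_def algebra_simps flip: powr_add)
  moreover have "slope h r = C * X * Y * (h r / \<theta> - q * (m / r powr \<tau>))"
  proof -
    have "(m / r powr \<tau>) powr (1 / \<theta> - 1) * r powr (\<tau> / \<theta> - q - 1)
            = X * (r powr (- \<tau> * (1 / \<theta> - 1)) * r powr (\<tau> / \<theta> - q - 1))"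
      using \<open>m > 0\<close> \<open>r > 0\<close> by (simp add: X_def powr_divide powr_powr powr_minus_divide)
    also have "r powr (- \<tau> * (1 / \<theta> - 1)) * r powr (\<tau> / \<theta> - q - 1) = Y"
      by (simp add: Y_def algebra_simps flip: powr_add)
    finally show ?thesis
      by (simp add: slope_def m_def mult.assoc)
  qed
  ultimately have "C * ((-q) * r powr (-q - 1) * m powr (1 / \<theta>)
      + (1 / \<theta>) * m powr (1 / \<theta> - 1) * (r powr (\<tau> - 1) * h r) * r powr (-q)) = slope h r"
    unfolding X_def[symmetric] by (simp add: algebra_simps)
  with deriv show ?thesis by simp
qed

text \<open>Convexity of the solution. For non-decreasing \<open>h\<close> the quotient \<open>moment h r / r powr \<tau>\<close> is at most
  \<open>h r / \<tau>\<close>, and \<open>\<theta> * q < \<tau>\<close> means \<open>q / \<tau> < 1 / \<theta>\<close>.\<close>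

lemma slope_pos:
  assumes h: "continuous_on {0..} h" and pos: "\<And>s. 0 \<le> s \<Longrightarrow> h s > 0" and "r > 0"
    and mono: "\<And>s. 0 \<le> s \<Longrightarrow> s \<le> r \<Longrightarrow> h s \<le> h r"
  shows "slope h r > 0"
proof -
  have "moment h r / r powr \<tau> \<le> h r / \<tau>"
    using moment_upper[OF h mono] \<open>r > 0\<close> \<tau>_pos by (simp add: field_simps)
  then have "q * (moment h r / r powr \<tau>) \<le> q * (h r / \<tau>)"
    using q_nonneg by (rule mult_left_mono)
  also have "\<dots> < h r / \<theta>"
    using pos[of r] \<open>r > 0\<close> \<tau>_pos \<theta>_pos \<theta>q_less by (simp add: field_simps)
  finally show ?thesis
    using moment_pos[OF h pos \<open>r > 0\<close>] \<open>r > 0\<close> C_pos by (simp add: slope_def)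
qed

lemma slope_continuous:
  assumes h: "continuous_on {0..} h" and pos: "\<And>s. 0 \<le> s \<Longrightarrow> h s > 0"
  shows "continuous_on {0<..} (slope h)"
proof -
  have "continuous_on {0<..} h" "continuous_on {0<..} (moment h)"
    using h moment_continuous[OF h] by (auto elim: continuous_on_subset)
  moreover have "moment h r \<noteq> 0" if "r > 0" for r
    using moment_pos[OF h pos that] by simp
  ultimately show ?thesis
    unfolding slope_def[abs_def] using \<theta>_pos
    by (intro continuous_intros) (auto simp: powr_def)
qed

lemma speed_over_power_limit:
  assumes h: "continuous_on {0..} h" and pos: "\<And>s. 0 \<le> s \<Longrightarrow> h s > 0"
  shows "((\<lambda>r. C * (moment h r / r powr \<tau>) powr (1 / \<theta>)) \<longlongrightarrow> C * (h 0 / \<tau>) powr (1 / \<theta>)) (at_right 0)"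
  using pos[of 0] \<tau>_pos by (intro tendsto_intros moment_ratio_limit[OF h]) auto

lemma speed_continuous:
  assumes h: "continuous_on {0..} h" and pos: "\<And>s. 0 \<le> s \<Longrightarrow> h s > 0"
  shows "continuous_on {0..} (speed h)"
  unfolding continuous_on_def
proof
  fix r :: real assume "r \<in> {0..}"
  show "(speed h \<longlongrightarrow> speed h r) (at r within {0..})"
  proof (cases "r = 0")
    case True
    have "((\<lambda>r. r powr (\<tau> / \<theta> - q)) \<longlongrightarrow> 0) (at_right 0)"
      using exponent_pos by (auto intro!: tendsto_eq_intros simp: eventually_at_filter)
    from tendsto_mult[OF speed_over_power_limit[OF h pos] this]
    have "((\<lambda>r. C * (moment h r / r powr \<tau>) powr (1 / \<theta>) * r powr (\<tau> / \<theta> - q)) \<longlongrightarrow> 0) (at_right 0)"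
      by simp
    then have "(speed h \<longlongrightarrow> 0) (at_right 0)"
      by (rule Lim_transform_eventually)
         (use speed_ratio[OF h pos] in \<open>auto simp: eventually_at_filter\<close>)
    then show ?thesis
      using True by (simp add: at_within_Ici_at_right)
  next
    case False
    then have "r > 0" using \<open>r \<in> {0..}\<close> by simp
    then have "isCont (speed h) r"
      using speed_derivative[OF h pos] DERIV_isCont by blast
    then show ?thesis
      unfolding isCont_def by (rule tendsto_within_subset) simp
  qed
qed

text \<open>The limit of \<open>slope h\<close> at the origin, in the cases \<open>\<tau> \<ge> \<theta> * (q + 1)\<close> in which it is finite.\<close>

definition slope_0 :: "(real \<Rightarrow> real) \<Rightarrow> real" where
  "slope_0 h = (if \<tau> = \<theta> * (q + 1) then C * (h 0 / \<tau>) powr (1 / \<theta>) else 0)"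

text \<open>Both limits carry the factor \<open>r powr (\<tau> / \<theta> - q - 1)\<close>, whose limit \<open>e\<close> is \<open>1\<close> or \<open>0\<close>. In the
  critical case the two limits agree because \<open>h 0 / \<theta> - q * h 0 / \<tau> = h 0 / \<tau>\<close>.\<close>

lemma slope_at_0:
  assumes h: "continuous_on {0..} h" and pos: "\<And>s. 0 \<le> s \<Longrightarrow> h s > 0"
    and ge: "\<tau> \<ge> \<theta> * (q + 1)"
  shows "((\<lambda>r. speed h r / r) \<longlongrightarrow> slope_0 h) (at_right 0)"
    and "(slope h \<longlongrightarrow> slope_0 h) (at_right 0)"
proof -
  define e :: real where "e = (if \<tau> = \<theta> * (q + 1) then 1 else 0)"
  have powr_lim: "((\<lambda>r. r powr (\<tau> / \<theta> - q - 1)) \<longlongrightarrow> e) (at_right 0)"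
  proof (cases "\<tau> = \<theta> * (q + 1)")
    case True
    then have "\<tau> / \<theta> - q - 1 = 0" using \<theta>_pos by (simp add: field_simps)
    then have "((\<lambda>r. r powr (\<tau> / \<theta> - q - 1)) \<longlongrightarrow> 1) (at_right 0) \<longleftrightarrow>
        ((\<lambda>r::real. 1) \<longlongrightarrow> (1::real)) (at_right 0)"
      by (intro filterlim_cong) (auto simp: eventually_at_filter)
    then show ?thesis using True by (simp add: e_def)
  next
    case False
    then have "\<tau> / \<theta> - q - 1 > 0" using \<theta>_pos ge by (simp add: field_simps)
    then show ?thesis
      using False by (auto intro!: tendsto_eq_intros simp: eventually_at_filter e_def)
  qed
  have h0: "h 0 / \<tau> > 0" using pos \<tau>_pos by simp
  have "((\<lambda>r. C * (moment h r / r powr \<tau>) powr (1 / \<theta>) * r powr (\<tau> / \<theta> - q - 1))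
           \<longlongrightarrow> C * (h 0 / \<tau>) powr (1 / \<theta>) * e) (at_right 0)"
    by (intro tendsto_mult speed_over_power_limit[OF h pos] powr_lim)
  then have "((\<lambda>r. speed h r / r) \<longlongrightarrow> C * (h 0 / \<tau>) powr (1 / \<theta>) * e) (at_right 0)"
    by (rule Lim_transform_eventually)
       (use speed_ratio[OF h pos] in \<open>auto simp: eventually_at_filter powr_diff\<close>)
  then show "((\<lambda>r. speed h r / r) \<longlongrightarrow> slope_0 h) (at_right 0)"
    by (simp add: slope_0_def e_def split: if_splits)
  note hlim = continuous_on_atLeast_right_limit[OF h]
  have "(slope h \<longlongrightarrow> C * (h 0 / \<tau>) powr (1 / \<theta> - 1) * e * (h 0 / \<theta> - q * (h 0 / \<tau>))) (at_right 0)"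
    unfolding slope_def[abs_def] using h0 \<theta>_pos
    by (intro tendsto_intros moment_ratio_limit[OF h] powr_lim hlim) auto
  also have "C * (h 0 / \<tau>) powr (1 / \<theta> - 1) * e * (h 0 / \<theta> - q * (h 0 / \<tau>)) = slope_0 h"
  proof (cases "\<tau> = \<theta> * (q + 1)")
    case True
    then have "h 0 / \<theta> = (q + 1) * (h 0 / \<tau>)"
      using \<theta>_pos \<tau>_pos q_nonneg by simp
    then have "h 0 / \<theta> - q * (h 0 / \<tau>) = h 0 / \<tau>"
      by (simp only: distrib_right)
    then have "C * (h 0 / \<tau>) powr (1 / \<theta> - 1) * e * (h 0 / \<theta> - q * (h 0 / \<tau>))
        = C * ((h 0 / \<tau>) powr (1 / \<theta> - 1) * (h 0 / \<tau>) powr 1)"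
      using True pos[of 0] \<tau>_pos unfolding e_def by (simp only: if_True powr_one h0 less_imp_le) simp
    also have "\<dots> = slope_0 h"
      unfolding powr_add[symmetric] slope_0_def using True by simp
    finally show ?thesis .
  qed (simp add: e_def slope_0_def)
  finally show "(slope h \<longlongrightarrow> slope_0 h) (at_right 0)" .
qed

section \<open>Solutions of the integral equation are regular and convex\<close>


lemma increasing_if_derivative_speed:
  assumes v: "continuous_on {0..} v" and h: "continuous_on {0..} h" and pos: "\<And>s. 0 \<le> s \<Longrightarrow> h s > 0"
    and dv: "\<And>r. 0 < r \<Longrightarrow> (v has_real_derivative speed h r) (at r)"
    and sr: "0 \<le> s" "s \<le> r"
  shows "v s \<le> v r"
proof (rule DERIV_nonneg_imp_increasing_open[OF \<open>s \<le> r\<close>])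
  fix x assume "s < x"
  then have "0 < x" using sr by simp
  then show "\<exists>y. (v has_real_derivative y) (at x) \<and> 0 \<le> y"
    using dv speed_pos[OF h pos] by (meson less_imp_le)
qed (rule continuous_on_subset[OF v], use sr in auto)

lemma speed_derivative_within:
  assumes h: "continuous_on {0..} h" and pos: "\<And>s. 0 \<le> s \<Longrightarrow> h s > 0"
    and ge: "\<tau> \<ge> \<theta> * (q + 1)" and "r \<in> {0..}"
  shows "(speed h has_real_derivative (if r = 0 then slope_0 h else slope h r)) (at r within {0..})"
proof (cases "r = 0")
  case True
  with slope_at_0(1)[OF h pos ge] show ?thesis
    by (simp add: has_field_derivative_iff at_within_Ici_at_right)
next
  case False
  with speed_derivative[OF h pos, of r] \<open>r \<in> {0..}\<close> show ?thesis
    by (auto intro: has_field_derivative_at_within)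
qed

text \<open>The fundamental theorem turns the integral equation into \<open>v' = speed h\<close> with \<open>h = g \<circ> v\<close>, also at the
  origin; the rest is what is known about \<open>speed h\<close> and \<open>slope h\<close> for a non-decreasing \<open>h\<close>.\<close>

lemma regularity_of_integral_solution:
  assumes g: "continuous_on UNIV g" "\<And>x. g x > 0" "mono g"
    and v: "continuous_on {0..} v"
    and eq: "\<And>r. 0 \<le> r \<Longrightarrow> v r = a + integral {0..r} (speed (\<lambda>s. g (v s)))"
  shows "convex_solution g q \<theta> C \<tau> a v" and "regularity g q \<theta> C \<tau> a v"
proof -
  define h where "h = (\<lambda>s. g (v s))"
  have h: "continuous_on {0..} h"
    unfolding h_def by (rule continuous_on_compose2[OF g(1) v]) auto
  have pos: "h s > 0" for s
    unfolding h_def by (rule g)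
  have cs: "continuous_on {0..} (speed h)"
    using h pos by (rule speed_continuous)
  have v0: "v 0 = a"
    using eq[of 0] by simp
  have dv: "(v has_real_derivative speed h r) (at r within {0..})" if "r \<in> {0..}" for r
  proof -
    have "((\<lambda>r. integral {0..r} (speed h)) has_real_derivative speed h r) (at r within {0..})"
      by (rule integral_from_derivative[OF continuous_on_atLeast_integrable[OF cs]])
         (use that cs in \<open>auto simp: continuous_on_eq_continuous_within\<close>)
    then have "((\<lambda>r. a + integral {0..r} (speed h)) has_real_derivative speed h r) (at r within {0..})"
      by (auto intro!: derivative_eq_intros)
    then show ?thesis
      by (rule has_field_derivative_transform_within[of _ _ _ _ 1]) (use that eq h_def in auto)
  qed
  have dv_at: "(v has_real_derivative speed h r) (at r)" if "r > 0" for r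
    using dv[of r] that at_within_interior[of r "{0..}"] by simp
  have mono: "h s \<le> h r" if "0 \<le> s" "s \<le> r" for s r
    unfolding h_def
    by (rule monoD[OF g(3) increasing_if_derivative_speed[OF v h pos dv_at that]])
  have ds: "(speed h has_real_derivative slope h r) (at r)" if "r > 0" for r
    using speed_derivative[OF h pos that] .
  have D1: "D1 v r = speed h r" if "r \<in> {0..}" for r
    by (rule deriv_on_eq[OF dv[OF that] at_within_atLeast_ne_bot[OF that]])
  have D2: "D2 v r = deriv_on {0..} (speed h) r" if "r \<in> {0..}" for r
    by (rule deriv_on_cong) (use D1 that in auto)
  have D2_pos: "D2 v r = slope h r" if "r > 0" for r
  proof -
    have "deriv_on {0..} (speed h) r = slope h r"
      by (rule deriv_on_eq[OF has_field_derivative_at_within[OF ds[OF that]]])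
         (use that at_within_atLeast_ne_bot[of r 0] in auto)
    then show ?thesis using D2[of r] that by simp
  qed
  have C1: "Ck_on 1 {0..} v"
    unfolding One_nat_def
    by (rule Ck_on_SucI[OF dv at_within_atLeast_ne_bot]) (auto simp: cs)
  have C2_open: "Ck_on 2 {0<..} v"
    unfolding numeral_2_eq_2
  proof (rule Ck_on_SucI)
    show "Ck_on (Suc 0) {0<..} (speed h)"
      by (rule Ck_on_SucI[of _ _ "slope h"])
         (auto simp: at_within_greaterThan ds slope_continuous[OF h pos])
  qed (auto simp: at_within_greaterThan dv_at)
  show "convex_solution g q \<theta> C \<tau> a v"
    unfolding convex_solution_def solves_P_def
    using v0 C1 C2_open D1 D2_pos dv_at speed_pos[OF h pos] slope_pos[OF h pos _ mono]
    by (auto simp: speed_def moment_def h_def)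
  have C2_closed: "Ck_on 2 {0..} v" "D2 v 0 = slope_0 h" if ge: "\<tau> \<ge> \<theta> * (q + 1)"
  proof -
    note ds' = speed_derivative_within[OF h pos ge]
    have "continuous_on {0..} (\<lambda>r. if r = 0 then slope_0 h else slope h r)"
      unfolding continuous_on_def
    proof
      fix r :: real assume "r \<in> {0..}"
      show "((\<lambda>r. if r = 0 then slope_0 h else slope h r) \<longlongrightarrow>
              (if r = 0 then slope_0 h else slope h r)) (at r within {0..})"
      proof (cases "r = 0")
        case True
        have "((\<lambda>r. if r = 0 then slope_0 h else slope h r) \<longlongrightarrow> slope_0 h) (at_right 0)"
          by (rule Lim_transform_eventually[OF slope_at_0(2)[OF h pos ge]])
             (auto simp: eventually_at_filter)
        then show ?thesis using True by (simp add: at_within_Ici_at_right)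
      next
        case False
        then have "r > 0" using \<open>r \<in> {0..}\<close> by simp
        have "isCont (slope h) r"
          using slope_continuous[OF h pos] \<open>r > 0\<close> by (simp add: continuous_on_eq_continuous_at)
        then have "(slope h \<longlongrightarrow> slope h r) (at r)"
          by (simp add: isCont_def)
        moreover have "\<forall>\<^sub>F s in at r. slope h s = (if s = 0 then slope_0 h else slope h s)"
        proof (rule eventually_mono)
          show "\<forall>\<^sub>F s in at r. s \<in> {0<..} - {r}"
            by (rule eventually_at_in_open) (use \<open>r > 0\<close> in auto)
        qed auto
        ultimately have "((\<lambda>r. if r = 0 then slope_0 h else slope h r) \<longlongrightarrow> slope h r) (at r)"
          by (rule Lim_transform_eventually)
        then show ?thesis
          using False tendsto_within_subset[of _ _ r UNIV "{0..}"] by simp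
      qed
    qed
    then show "Ck_on 2 {0..} v"
      unfolding numeral_2_eq_2
      by (intro Ck_on_SucI[OF dv] Ck_on_SucI[OF ds'] at_within_atLeast_ne_bot) auto
    have "deriv_on {0..} (speed h) 0 = slope_0 h"
      using deriv_on_eq[OF ds' at_within_atLeast_ne_bot, of 0] by simp
    then show "D2 v 0 = slope_0 h" using D2[of 0] by simp
  qed
  have "Sobolev_loc 2 \<delta> {0<..} v" if "1 < \<delta>" for \<delta>
    by (rule Sobolev_loc_C2[OF dv_at ds slope_continuous[OF h pos]]) (use that in auto)
  with C2_open C2_closed show "regularity g q \<theta> C \<tau> a v"
    unfolding regularity_def by (auto simp: slope_0_def h_def v0)
qed

section \<open>Necessity of the integral condition\<close>


text \<open>For \<open>\<tau> \<le> 1\<close> the weight is at least its value at \<open>r\<close>. For \<open>\<tau> > 1\<close> this is Chebyshev's inequality for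
  the two non-decreasing functions \<open>h\<close> and \<open>s powr (\<tau> - 1)\<close>. In either case a suitable difference
  \<open>?\<Psi>\<close> that vanishes at \<open>0\<close> is shown to be non-decreasing.\<close>

lemma mean_le_moment:
  assumes h: "continuous_on {0..} h" and pos: "\<And>s. 0 \<le> s \<Longrightarrow> h s > 0"
    and mono: "\<And>s r. 0 \<le> s \<Longrightarrow> s \<le> r \<Longrightarrow> h s \<le> h r" and "r > 0"
  shows "r powr (\<tau> - 1) * integral {0..r} h \<le> max 1 \<tau> * moment h r"
proof -
  define H where "H = (\<lambda>x. integral {0..x} h)"
  have hi: "h integrable_on {0..b}" for b
    by (rule continuous_on_atLeast_integrable[OF h])
  have dH: "(H has_real_derivative h x) (at x)" if "x > 0" for x
    unfolding H_def by (rule integral_from_derivative_at[OF hi that continuous_on_atLeast_at[OF h that]])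
  have cH: "continuous_on {0..r} H"
    unfolding H_def by (rule continuous_on_subset[OF integral_from_continuous[OF hi]]) auto
  have cm: "continuous_on {0..r} (moment h)"
    by (rule continuous_on_subset[OF moment_continuous[OF h]]) auto
  show ?thesis
  proof (cases "\<tau> \<le> 1")
    case True
    let ?\<Psi> = "\<lambda>x. moment h x - r powr (\<tau> - 1) * H x"
    have "?\<Psi> 0 \<le> ?\<Psi> r"
    proof (rule DERIV_nonneg_imp_increasing_open[where f = ?\<Psi>])
      fix x assume x: "0 < x" "x < r"
      have "(?\<Psi> has_real_derivative (x powr (\<tau> - 1) * h x - r powr (\<tau> - 1) * h x)) (at x)"
        using x by (intro DERIV_diff DERIV_cmult dH moment_derivative[OF h]) auto
      moreover have "r powr (\<tau> - 1) \<le> x powr (\<tau> - 1)"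
        using x True by (intro powr_mono2') auto
      then have "0 \<le> x powr (\<tau> - 1) * h x - r powr (\<tau> - 1) * h x"
        using pos[of x] x by (simp add: mult_right_mono)
      ultimately show "\<exists>y. (?\<Psi> has_real_derivative y) (at x) \<and> 0 \<le> y" by blast
    qed (use \<open>r > 0\<close> cm cH in \<open>auto intro!: continuous_intros\<close>)
    then show ?thesis
      using True by (simp add: H_def)
  next
    case False
    then have "\<tau> > 1" by simp
    let ?\<Psi> = "\<lambda>x. \<tau> * moment h x - x powr (\<tau> - 1) * H x"
    have "?\<Psi> 0 \<le> ?\<Psi> r"
    proof (rule DERIV_nonneg_imp_increasing_open[where f = ?\<Psi>])
      fix x assume x: "0 < x" "x < r"
      \<comment> \<open>The derivative of \<open>?\<Psi>\<close> is a positive multiple of \<open>x * h x - H x\<close>.\<close>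
      have "H x \<le> integral {0..x} (\<lambda>_. h x)"
        unfolding H_def by (rule integral_le[OF hi]) (use mono in auto)
      then have Hx: "H x \<le> x * h x" using x by simp
      have px: "x powr (\<tau> - 1) = x powr (\<tau> - 2) * x"
        using x powr_add[of x "\<tau> - 2" 1] by simp
      have "(?\<Psi> has_real_derivative \<tau> * (x powr (\<tau> - 1) * h x)
          - ((\<tau> - 1) * x powr (\<tau> - 1 - 1) * H x + h x * x powr (\<tau> - 1))) (at x)"
        using x by (intro DERIV_diff DERIV_cmult DERIV_mult dH moment_derivative[OF h]
            has_real_derivative_powr) auto
      moreover have "\<tau> * (x powr (\<tau> - 1) * h x) - ((\<tau> - 1) * x powr (\<tau> - 1 - 1) * H x + h x * x powr (\<tau> - 1))
          = (\<tau> - 1) * x powr (\<tau> - 2) * (x * h x - H x)"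
        unfolding px by (simp add: algebra_simps)
      moreover have "0 \<le> (\<tau> - 1) * x powr (\<tau> - 2) * (x * h x - H x)"
        using \<open>\<tau> > 1\<close> Hx by simp
      ultimately show "\<exists>y. (?\<Psi> has_real_derivative y) (at x) \<and> 0 \<le> y" by metis
    qed (use \<open>r > 0\<close> \<open>\<tau> > 1\<close> cm cH in \<open>auto intro!: continuous_intros continuous_on_powr'\<close>)
    then show ?thesis
      using \<open>\<tau> > 1\<close> by (simp add: H_def)
  qed
qed

lemma moment_eq_speed:
  assumes h: "continuous_on {0..} h" and pos: "\<And>s. 0 \<le> s \<Longrightarrow> h s > 0" and "r > 0"
  shows "moment h r = C powr (-\<theta>) * r powr (\<theta> * q) * speed h r powr \<theta>"
proof -
  have "speed h r powr \<theta> = C powr \<theta> * r powr (- (\<theta> * q)) * moment h r powr 1"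
    unfolding speed_def using moment_pos[OF assms] \<open>r > 0\<close> C_pos \<theta>_pos
    by (simp only: powr_mult powr_powr) (simp add: mult.commute)
  then show ?thesis
    using moment_pos[OF assms] \<open>r > 0\<close> C_pos by (simp add: powr_minus field_simps)
qed

text \<open>The energy inequality naturally involves \<open>\<integral> g\<close> over \<open>[v 0, v r]\<close>, whereas the condition is about
  primitives from \<open>0\<close> and integration from \<open>c\<close>, and \<open>v 0\<close> may be negative or larger than \<open>c\<close>. The
  two are comparable once \<open>v r\<close> is large.\<close>

lemma integral_condition_necessary:
  assumes g: "continuous_on UNIV g" "\<And>x. g x > 0" "mono g"
    and v: "continuous_on {0..} v"
    and dv: "\<And>r. 0 < r \<Longrightarrow> (v has_real_derivative speed (\<lambda>s. g (v s)) r) (at r)"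
    and "c > 0"
  shows "(\<integral>\<^sup>+ t\<in>{c..}. ennreal ((integral {0..t} g) powr (- (1 / (\<theta> + 1)))) \<partial>lborel) = \<infinity>"
proof -
  define h where "h = (\<lambda>s. g (v s))"
  define w where "w = speed h"
  have dv: "(v has_real_derivative w r) (at r)" if "r > 0" for r
    using dv[OF that] by (simp add: w_def h_def)
  have h: "continuous_on {0..} h"
    unfolding h_def by (rule continuous_on_compose2[OF g(1) v]) auto
  have pos: "h s > 0" for s
    unfolding h_def by (rule g)
  have wpos: "w r > 0" if "r > 0" for r
    unfolding w_def using speed_pos[OF h pos that] .
  have vmono: "v s \<le> v r" if "0 \<le> s" "s \<le> r" for s r
    by (rule increasing_if_derivative_speed[OF v h pos dv[unfolded w_def] that])
  have mono: "h s \<le> h r" if "0 \<le> s" "s \<le> r" for s r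
    unfolding h_def using vmono[OF that] g(3) by (rule monoD[rotated])
  have wmono: "w s \<le> w r" if "0 < s" "s \<le> r" for s r
  proof (rule DERIV_nonneg_imp_nondecreasing[OF \<open>s \<le> r\<close>])
    fix x assume "s \<le> x"
    then have "0 < x" using that by simp
    with speed_derivative[OF h pos] slope_pos[OF h pos _ mono]
    show "\<exists>y. (w has_real_derivative y) (at x) \<and> 0 \<le> y"
      unfolding w_def by (meson less_imp_le)
  qed
  have gi: "g integrable_on {x..y}" for x y
    by (rule integrable_continuous_real) (rule continuous_on_subset[OF g(1)], auto)
  have gc: "isCont g x" for x
    using g(1) by (simp add: continuous_on_eq_continuous_at)
  have gc': "continuous_on {x..} g" for x
    using g(1) by (rule continuous_on_subset) auto

  define a where "a = v 0"
  define \<Delta> where "\<Delta> = (\<lambda>r. integral {a..v r} g)"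
  define M where "M = max 1 \<tau> * C powr (-\<theta>)"
  have "M > 0" unfolding M_def using C_pos by simp
  have step1: "\<Delta> r \<le> w r * integral {0..r} h" if "r > 0" for r
  proof -
    let ?\<Phi> = "\<lambda>x. w r * integral {0..x} h - \<Delta> x"
    have "?\<Phi> 0 \<le> ?\<Phi> r"
    proof (rule DERIV_nonneg_imp_increasing_open[where f = ?\<Phi>])
      fix x assume x: "0 < x" "x < r"
      have "v (x / 2) < v x"
      proof (rule DERIV_pos_imp_increasing[where f = v])
        fix y assume "x / 2 \<le> y"
        then have "0 < y" using x by simp
        then show "\<exists>z. (v has_real_derivative z) (at y) \<and> 0 < z"
          using dv wpos by blast
      qed (use x in simp)
      moreover have "a \<le> v (x / 2)" unfolding a_def using x by (intro vmono) auto
      ultimately have "a < v x" by simp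
      have "((\<lambda>t. integral {a..t} g) has_real_derivative g (v x)) (at (v x))"
        by (rule integral_from_derivative_at[OF gi \<open>a < v x\<close> gc])
      from DERIV_chain2[OF this dv[OF x(1)]]
      have "(\<Delta> has_real_derivative h x * w x) (at x)"
        unfolding \<Delta>_def h_def .
      moreover have "((\<lambda>x. integral {0..x} h) has_real_derivative h x) (at x)"
        by (rule integral_from_derivative_at[OF continuous_on_atLeast_integrable[OF h] x(1)
              continuous_on_atLeast_at[OF h x(1)]])
      ultimately have "(?\<Phi> has_real_derivative w r * h x - h x * w x) (at x)"
        by (intro DERIV_diff DERIV_cmult)
      moreover have "h x * w x \<le> h x * w r"
        using wmono[of x r] x pos[of x] by (intro mult_left_mono) auto
      ultimately show "\<exists>y. (?\<Phi> has_real_derivative y) (at x) \<and> 0 \<le> y"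
        by (metis diff_ge_0_iff_ge mult.commute)
    next
      have "continuous_on {0..r} \<Delta>"
        unfolding \<Delta>_def
      proof (rule continuous_on_compose2[OF integral_from_continuous[OF gi]])
        show "continuous_on {0..r} v" by (rule continuous_on_subset[OF v]) auto
        show "v ` {0..r} \<subseteq> {a..}" using vmono unfolding a_def by auto
      qed
      moreover have "continuous_on {0..r} (\<lambda>x. integral {0..x} h)"
        by (rule indefinite_integral_continuous_1[OF continuous_on_atLeast_integrable[OF h]])
      ultimately show "continuous_on {0..r} ?\<Phi>"
        by (intro continuous_intros)
    qed (use that in simp)
    then show ?thesis by (simp add: \<Delta>_def a_def)
  qed
  have step2: "\<Delta> r \<le> M * (r * w r) powr (\<theta> + 1)" if "r \<ge> 1" for r
  proof -
    have "r > 0" using that by simp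
    have p: "r powr (1 - \<tau>) * r powr (\<tau> - 1) = 1"
      using \<open>r > 0\<close> by (simp flip: powr_add)
    have "\<Delta> r \<le> w r * (r powr (1 - \<tau>) * (r powr (\<tau> - 1) * integral {0..r} h))"
      using step1[OF \<open>r > 0\<close>] by (simp add: p flip: mult.assoc)
    also have "\<dots> \<le> w r * (r powr (1 - \<tau>) * (max 1 \<tau> * moment h r))"
      using wpos[OF \<open>r > 0\<close>] mean_le_moment[OF h pos mono \<open>r > 0\<close>]
      by (intro mult_left_mono) auto
    also have "\<dots> = M * (r powr (1 - \<tau>) * r powr (\<theta> * q)) * (w r powr \<theta> * w r)"
      unfolding moment_eq_speed[OF h pos \<open>r > 0\<close>] by (simp add: M_def w_def)
    also have "r powr (1 - \<tau>) * r powr (\<theta> * q) = r powr (1 - \<tau> + \<theta> * q)"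
      by (simp flip: powr_add)
    \<comment> \<open>Here \<open>\<theta> * q < \<tau>\<close> makes the exponent smaller than \<open>1\<close>, hence smaller than \<open>\<theta> + 1\<close>; that choice
      combines the power of \<open>r\<close> with the power of \<open>w r\<close>.\<close>
    also have "M * r powr (1 - \<tau> + \<theta> * q) * (w r powr \<theta> * w r)
        \<le> M * r powr (\<theta> + 1) * (w r powr \<theta> * w r)"
      using that \<theta>q_less \<theta>_pos \<open>M > 0\<close> wpos[OF \<open>r > 0\<close>]
      by (intro mult_right_mono mult_left_mono powr_mono) auto
    also have "\<dots> = M * (r * w r) powr (\<theta> + 1)"
      using wpos[OF \<open>r > 0\<close>] \<open>r > 0\<close> by (simp add: powr_mult powr_add)
    finally show ?thesis .
  qed

  define G where "G = (\<lambda>t. integral {0..t} g)"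
  have Gle: "G t - G a \<le> integral {a..t} g" if "a \<le> t" "0 \<le> t" for t
  proof (cases "a \<ge> 0")
    case True
    then show ?thesis
      unfolding G_def using integral_difference[OF gc', of 0 a t] that by simp
  next
    case False
    then have "integral {a..t} g - integral {a..0} g = G t"
      unfolding G_def using that by (intro integral_difference gc') auto
    moreover have "integral {a..0} g \<ge> 0"
      by (rule integral_nonneg[OF gi]) (use g(2) less_imp_le in blast)
    moreover have "G a = 0" unfolding G_def using False by simp
    ultimately show ?thesis by simp
  qed
  have Gge: "g 0 * t \<le> G t" if "t \<ge> 0" for t
    using integral_ge_initial_value[OF gi _ that] monoD[OF g(3)] by (simp add: G_def mult.commute)
  \<comment> \<open>Beyond \<open>t0\<close> the primitives from \<open>0\<close> and from \<open>a\<close> are comparable: \<open>G t \<ge> g 0 * t \<ge> 2 * G a\<close>. For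
    negative \<open>a\<close> the integral \<open>G a\<close> is over the empty set, hence \<open>0\<close>, which only helps.\<close>
  define t0 where "t0 = max (c + 1) (max a (2 * G a / g 0))"
  have G2: "0 < G t" "G t \<le> 2 * integral {a..t} g" if "t \<ge> t0" for t
  proof -
    have t: "t \<ge> c + 1" "t \<ge> a" "t \<ge> 2 * G a / g 0" using that by (auto simp: t0_def)
    then have "2 * G a \<le> g 0 * t" using g(2)[of 0] by (simp add: field_simps)
    also have "\<dots> \<le> G t" using Gge t \<open>c > 0\<close> by simp
    finally show "G t \<le> 2 * integral {a..t} g" using Gle[of t] t \<open>c > 0\<close> by simp
    have "0 < g 0 * t" using g(2)[of 0] t \<open>c > 0\<close> by simp
    then show "0 < G t" using Gge[of t] t \<open>c > 0\<close> by simp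
  qed
  \<comment> \<open>From \<open>1\<close> on, \<open>v\<close> grows at least with the rate \<open>w 1\<close>, so it has reached \<open>t0\<close> at \<open>r1\<close>.\<close>
  define r1 where "r1 = 1 + max 0 ((t0 - v 1) / w 1)"
  have "r1 \<ge> 1" by (simp add: r1_def)
  have vlarge: "v r \<ge> t0" if "r \<ge> r1" for r
  proof -
    have "r \<ge> 1" using that \<open>r1 \<ge> 1\<close> by simp
    have "v 1 - w 1 * 1 \<le> v r - w 1 * r"
    proof (rule DERIV_nonneg_imp_nondecreasing[OF \<open>r \<ge> 1\<close>])
      fix x :: real assume x: "1 \<le> x"
      have "((\<lambda>x. v x - w 1 * x) has_real_derivative w x - w 1 * 1) (at x)"
        using x by (intro DERIV_diff DERIV_cmult DERIV_ident dv) auto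
      then show "\<exists>y. ((\<lambda>x. v x - w 1 * x) has_real_derivative y) (at x) \<and> 0 \<le> y"
        using wmono[of 1 x] x by force
    qed
    moreover have "(t0 - v 1) / w 1 \<le> r - 1"
      using that by (simp add: r1_def)
    then have "t0 - v 1 \<le> (r - 1) * w 1"
      using wpos[of 1] by (simp add: pos_divide_le_eq)
    ultimately show ?thesis by (simp add: algebra_simps)
  qed

  define K where "K = (2 * M) powr (1 / (\<theta> + 1))"
  have "K > 0" using \<open>M > 0\<close> by (simp add: K_def)
  define f where "f = (\<lambda>t. G t powr (- (1 / (\<theta> + 1))))"
  have fv: "1 / (K * r) \<le> f (v r) * w r" if "r \<ge> r1" for r
  proof -
    have "r \<ge> 1" using that \<open>r1 \<ge> 1\<close> by simp
    have "G (v r) \<le> 2 * \<Delta> r" "0 < G (v r)"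
      using G2 vlarge[OF that] by (auto simp: \<Delta>_def)
    then have "G (v r) \<le> 2 * M * (r * w r) powr (\<theta> + 1)"
      using step2[OF \<open>r \<ge> 1\<close>] by simp
    then have "G (v r) powr (1 / (\<theta> + 1)) \<le> (2 * M * (r * w r) powr (\<theta> + 1)) powr (1 / (\<theta> + 1))"
      using \<theta>_pos \<open>0 < G (v r)\<close> by (intro powr_mono2) auto
    also have "\<dots> = K * (r * w r)"
      using \<open>M > 0\<close> \<open>r \<ge> 1\<close> wpos[of r] \<theta>_pos by (simp add: powr_mult powr_powr K_def)
    finally have "G (v r) powr (1 / (\<theta> + 1)) \<le> K * (r * w r)" .
    then show ?thesis
      using \<open>0 < G (v r)\<close> \<open>K > 0\<close> \<open>r \<ge> 1\<close> wpos[of r]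
      by (simp add: f_def powr_minus field_simps)
  qed
  have Gpos: "G t > 0" if "t \<ge> c" for t
    using Gge[of t] that \<open>c > 0\<close> g(2)[of 0] by (smt (verit) mult_pos_pos)
  have fc: "continuous_on {c..} f"
  proof -
    have "continuous_on {c..} G"
      unfolding G_def
      by (rule continuous_on_subset[OF integral_from_continuous[OF gi]]) (use \<open>c > 0\<close> in auto)
    then show ?thesis
      unfolding f_def using Gpos by (intro continuous_intros) fastforce+
  qed
  define F where "F = (\<lambda>T. integral {c..T} f)"
  have Fge: "(ln R - ln r1) / K \<le> F (v R)" if "R \<ge> r1" for R
  proof -
    have "F (v r1) - ln r1 / K \<le> F (v R) - ln R / K"
    proof (rule DERIV_nonneg_imp_nondecreasing[OF that])
      fix x assume x: "r1 \<le> x"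
      then have "v x \<ge> t0" "x > 0" using vlarge \<open>r1 \<ge> 1\<close> by auto
      then have "v x > c" by (simp add: t0_def)
      have "(F has_real_derivative f (v x)) (at (v x))"
        unfolding F_def
        by (rule integral_from_derivative_at[OF continuous_on_atLeast_integrable[OF fc] \<open>v x > c\<close>
              continuous_on_atLeast_at[OF fc \<open>v x > c\<close>]])
      from DERIV_chain2[OF this dv[OF \<open>x > 0\<close>]]
      have "((\<lambda>x. F (v x) - ln x / K) has_real_derivative f (v x) * w x - inverse x / K) (at x)"
        using \<open>x > 0\<close> by (intro DERIV_diff DERIV_cdivide DERIV_ln) auto
      moreover have "0 \<le> f (v x) * w x - inverse x / K"
        using fv[OF x] by (simp add: field_simps)
      ultimately show "\<exists>y. ((\<lambda>x. F (v x) - ln x / K) has_real_derivative y) (at x) \<and> 0 \<le> y"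
        by blast
    qed
    moreover have "F (v r1) \<ge> 0"
      unfolding F_def
      by (rule integral_nonneg[OF continuous_on_atLeast_integrable[OF fc]]) (simp add: f_def)
    ultimately show ?thesis by (simp add: diff_divide_distrib)
  qed
  have "\<exists>T\<ge>c. B < integral {c..T} f" for B
  proof -
    define R where "R = r1 * exp (K * (\<bar>B\<bar> + 1))"
    have "r1 * 1 \<le> R"
      unfolding R_def using \<open>r1 \<ge> 1\<close> \<open>K > 0\<close> by (intro mult_left_mono) auto
    then have R: "R \<ge> r1" by simp
    have "(ln R - ln r1) / K = \<bar>B\<bar> + 1"
      unfolding R_def using \<open>r1 \<ge> 1\<close> \<open>K > 0\<close> by (simp add: ln_mult)
    with Fge[OF R] have "B < F (v R)" by simp
    moreover have "v R \<ge> c" using vlarge[OF R] by (simp add: t0_def)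
    ultimately show ?thesis unfolding F_def by blast
  qed
  then have "(\<integral>\<^sup>+ t\<in>{c..}. ennreal (f t) \<partial>lborel) = \<infinity>"
    by (subst nn_integral_atLeast_eq_infinity_iff[OF fc]) (auto simp: f_def)
  then show ?thesis by (simp add: f_def G_def)
qed

section \<open>A priori bound\<close>

text \<open>Hoelder's inequality for the weight \<open>s powr (\<tau> - 1)\<close> and \<open>h\<close>. The conjugate power of the weight is
  integrable at the origin, which is \<open>e > 0\<close>, because \<open>1 < \<kappa> * \<tau>\<close>.\<close>

lemma speed_le_Hoelder:
  fixes \<kappa> r :: real and h :: "real \<Rightarrow> real"
  defines "\<kappa>' \<equiv> \<kappa> / (\<kappa> - 1)"
  defines "e \<equiv> (\<tau> - 1) * \<kappa>' + 1"
  assumes h: "continuous_on {0..} h" and pos: "\<And>s. h s > 0"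
    and \<kappa>: "\<kappa> > 1" "1 < \<kappa> * \<tau>" and "r > 0"
  shows "speed h r \<le> C * (1 / e) powr (1 / (\<kappa>' * \<theta>)) * r powr ((\<tau> - 1 / \<kappa>) / \<theta> - q)
                * integral {0..r} (\<lambda>s. h s powr \<kappa>) powr (1 / (\<kappa> * \<theta>))"
proof -
  define J where "J = integral {0..r} (\<lambda>s. h s powr \<kappa>)"
  have \<kappa>': "\<kappa>' > 1" "1 / \<kappa> + 1 / \<kappa>' = 1" "1 / \<kappa>' = 1 - 1 / \<kappa>"
    using \<kappa> by (simp_all add: \<kappa>'_def field_simps)
  have e_eq: "e / \<kappa>' = \<tau> - 1 / \<kappa>"
    using \<kappa>' by (simp add: e_def add_divide_distrib)
  moreover have "\<tau> - 1 / \<kappa> > 0" using \<kappa> by (simp add: field_simps)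
  ultimately have "e > 0" using \<kappa>'(1) by (metis zero_less_divide_iff less_trans zero_less_one not_less_iff_gr_or_eq)
  have hc: "continuous_on {0..} (\<lambda>s. h s powr \<kappa>)"
    using pos h by (intro continuous_intros) (auto simp: less_imp_neq[OF pos, symmetric])
  have "J > 0"
  proof -
    obtain x where x: "x \<in> {0..r}" "\<And>y. y \<in> {0..r} \<Longrightarrow> h x \<le> h y"
      using continuous_attains_inf[of "{0..r}" h] continuous_on_subset[OF h, of "{0..r}"] \<open>r > 0\<close> by auto
    have "integral {0..r} (\<lambda>_. h x powr \<kappa>) \<le> J"
      unfolding J_def using \<kappa> x less_imp_le[OF pos]
      by (intro integral_le continuous_on_atLeast_integrable[OF hc]) (auto intro: powr_mono2)
    moreover have "0 < r * h x powr \<kappa>" using \<open>r > 0\<close> pos[of x] by simp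
    ultimately show ?thesis using \<open>r > 0\<close> by simp
  qed
  have W: "((\<lambda>s. (s powr (\<tau> - 1)) powr \<kappa>') has_integral (r powr e / e)) {0..r}"
    using has_integral_powr_from_0[of "(\<tau> - 1) * \<kappa>'" r] \<open>e > 0\<close> \<open>r > 0\<close>
    by (simp add: e_def powr_powr)
  have "moment h r \<le> (r powr e / e) powr (1 / \<kappa>') * J powr (1 / \<kappa>)"
  proof -
    have "integral {0..r} (\<lambda>s. s powr (\<tau> - 1) * h s)
       \<le> integral {0..r} (\<lambda>s. (s powr (\<tau> - 1)) powr \<kappa>') powr (1 / \<kappa>')
         * integral {0..r} (\<lambda>s. h s powr \<kappa>) powr (1 / \<kappa>)"
      using \<kappa> \<kappa>' W \<open>e > 0\<close> \<open>r > 0\<close> \<open>J > 0\<close> less_imp_le[OF pos]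
      by (intro Hoelder_integral weighted_integrable[OF h] continuous_on_atLeast_integrable[OF hc])
         (auto simp: integral_unique[OF W] J_def)
    then show ?thesis
      unfolding moment_def by (simp add: integral_unique[OF W] J_def)
  qed
  then have "moment h r powr (1 / \<theta>) \<le> ((r powr e / e) powr (1 / \<kappa>') * J powr (1 / \<kappa>)) powr (1 / \<theta>)"
    using \<theta>_pos moment_nonneg[OF h pos] by (intro powr_mono2) auto
  also have "\<dots> = (1 / e) powr (1 / (\<kappa>' * \<theta>)) * r powr (e / \<kappa>' / \<theta>) * J powr (1 / (\<kappa> * \<theta>))"
    using \<open>e > 0\<close> \<open>r > 0\<close> \<open>J > 0\<close> by (simp add: powr_mult powr_divide powr_powr)
  finally have "speed h r \<le> C * r powr (- q) *
      ((1 / e) powr (1 / (\<kappa>' * \<theta>)) * r powr (e / \<kappa>' / \<theta>) * J powr (1 / (\<kappa> * \<theta>)))"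
    unfolding speed_def using C_pos by (intro mult_left_mono) auto
  also have "\<dots> = C * (1 / e) powr (1 / (\<kappa>' * \<theta>)) * (r powr (- q) * r powr (e / \<kappa>' / \<theta>)) * J powr (1 / (\<kappa> * \<theta>))"
    by simp
  also have "r powr (- q) * r powr (e / \<kappa>' / \<theta>) = r powr ((\<tau> - 1 / \<kappa>) / \<theta> - q)"
    by (simp add: e_eq flip: powr_add)
  finally show ?thesis by (simp add: J_def)
qed

text \<open>A Keller-Osserman argument for subsolutions. The bound depends on \<open>R\<close> but not on the subsolution
  \<open>u\<close>, whose derivative is \<open>w\<close>. The initial value is taken equal to the lower limit \<open>c\<close> of the divergent
  integral.\<close>

lemma a_priori_bound:
  assumes g: "continuous_on UNIV g" "\<And>x. g x > 0" "mono g"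
    and \<kappa>: "\<kappa> > 1" "1 < \<kappa> * (\<tau> - \<theta> * q)" and "c > 0" and "R > 0"
    and unb: "\<And>B. \<exists>T\<ge>c. B < integral {c..T} (\<lambda>t. integral {0..t} (\<lambda>s. g s powr \<kappa>) powr (- (1 / (\<kappa> * \<theta> + 1))))"
  obtains B where "\<And>u w r. continuous_on {0..} u \<Longrightarrow> u 0 = c \<Longrightarrow>
      (\<And>r. 0 < r \<Longrightarrow> (u has_real_derivative w r) (at r)) \<Longrightarrow>
      (\<And>r. 0 < r \<Longrightarrow> w r \<le> speed (\<lambda>s. g (u s)) r) \<Longrightarrow> 0 \<le> r \<Longrightarrow> r \<le> R \<Longrightarrow> u r \<le> B"
proof -
  define m where "m = \<kappa> * \<theta>"
  have "m > 0" using \<kappa> \<theta>_pos by (simp add: m_def)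
  have \<kappa>\<tau>: "1 < \<kappa> * \<tau>"
  proof -
    have "\<kappa> * (\<tau> - \<theta> * q) \<le> \<kappa> * \<tau>"
      using \<kappa>(1) \<theta>_pos q_nonneg by (intro mult_left_mono) auto
    with \<kappa>(2) show ?thesis by (rule less_le_trans)
  qed
  define gk where "gk = (\<lambda>s. g s powr \<kappa>)"
  have gkpos: "gk s > 0" for s unfolding gk_def using g(2)[of s] by simp
  have gkmono: "gk s \<le> gk t" if "s \<le> t" for s t
    unfolding gk_def using \<kappa> g(2)[of s] monoD[OF g(3) that] by (intro powr_mono2) auto
  have gkc: "continuous_on UNIV gk"
    unfolding gk_def using g by (intro continuous_intros) (auto simp: less_imp_neq[OF g(2), symmetric])
  have gkc': "isCont gk x" for x
    using gkc by (simp add: continuous_on_eq_continuous_at)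
  have gki: "gk integrable_on {x..y}" for x y
    by (rule integrable_continuous_real) (rule continuous_on_subset[OF gkc], auto)
  define G where "G = (\<lambda>t. integral {0..t} gk)"
  have dG: "(G has_real_derivative gk t) (at t)" if "t > 0" for t
    unfolding G_def by (rule integral_from_derivative_at[OF gki that gkc'])
  have Gpos: "G t > 0" if "t > 0" for t
  proof -
    have "0 < t * gk 0" using that gkpos by simp
    also have "\<dots> \<le> G t"
      unfolding G_def by (rule integral_ge_initial_value[OF gki]) (use that gkmono in auto)
    finally show ?thesis .
  qed
  have Gc: "continuous_on {c..} G"
    unfolding G_def
    by (rule continuous_on_subset[OF integral_from_continuous[OF gki]]) (use \<open>c > 0\<close> in auto)
  define f where "f = (\<lambda>t. G t powr (- (1 / (m + 1))))"
  have fc: "continuous_on {c..} f"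
    unfolding f_def
  proof (intro continuous_on_powr Gc continuous_on_const ballI)
    fix t assume "t \<in> {c..}"
    with \<open>c > 0\<close> Gpos[of t] show "G t \<noteq> 0" by simp
  qed
  define F where "F = (\<lambda>T. integral {c..T} f)"
  have Fc: "continuous_on {c..} F"
    unfolding F_def by (rule integral_from_continuous[OF continuous_on_atLeast_integrable[OF fc]])
  have dF: "(F has_real_derivative f t) (at t)" if "t > c" for t
    unfolding F_def
    by (rule integral_from_derivative_at[OF continuous_on_atLeast_integrable[OF fc] that
          continuous_on_atLeast_at[OF fc that]])

  define \<kappa>' where "\<kappa>' = \<kappa> / (\<kappa> - 1)"
  define e where "e = (\<tau> - 1) * \<kappa>' + 1"
  \<comment> \<open>The factor in front of \<open>J\<close> in \<open>speed_le_Hoelder\<close> at \<open>r = R\<close>, made positive by adding \<open>1\<close>.\<close>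
  define K where "K = C * (1 / e) powr (1 / (\<kappa>' * \<theta>)) * R powr ((\<tau> - 1 / \<kappa>) / \<theta> - q) + 1"
  have "K > 0" unfolding K_def using C_pos by (smt (verit) mult_nonneg_nonneg powr_ge_zero)
  define L where "L = ((m + 1) / (m * K)) powr (1 / (m + 1))"
  have "L > 0" unfolding L_def using \<open>m > 0\<close> \<open>K > 0\<close> by simp
  obtain T where T: "T \<ge> c" "K * L * R < F T"
    using unb[of "K * L * R"] unfolding F_def f_def G_def gk_def m_def by blast

  have "u r \<le> T"
    if u: "continuous_on {0..} u" and u0: "u 0 = c"
      and du: "\<And>r. 0 < r \<Longrightarrow> (u has_real_derivative w r) (at r)"
      and wle: "\<And>r. 0 < r \<Longrightarrow> w r \<le> speed (\<lambda>s. g (u s)) r"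
      and r: "0 \<le> r" "r \<le> R" for u w r
  proof -
    define h where "h = (\<lambda>s. g (u s))"
    have h: "continuous_on {0..} h"
      unfolding h_def by (rule continuous_on_compose2[OF g(1) u]) auto
    have pos: "h s > 0" for s unfolding h_def by (rule g)
    have hkc: "continuous_on {0..} (\<lambda>s. gk (u s))"
      by (rule continuous_on_compose2[OF gkc u]) auto
    define J where "J = (\<lambda>r. integral {0..r} (\<lambda>s. gk (u s)))"
    have dJ: "(J has_real_derivative gk (u x)) (at x)" if "x > 0" for x
      unfolding J_def
      by (rule integral_from_derivative_at[OF continuous_on_atLeast_integrable[OF hkc] that
            continuous_on_atLeast_at[OF hkc that]])
    have Jc: "continuous_on {0..} J"
      unfolding J_def by (rule integral_from_continuous[OF continuous_on_atLeast_integrable[OF hkc]])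
    have J0: "J 0 = 0" by (simp add: J_def)
    have Jpos: "J x > 0" if "x > 0" for x
    proof -
      have "J 0 < J x"
        by (rule DERIV_pos_imp_increasing_open[OF that])
           (use dJ gkpos in blast, rule continuous_on_subset[OF Jc], auto)
      then show ?thesis by (simp add: J0)
    qed
    have Jnn: "J x \<ge> 0" if "x \<ge> 0" for x
      using Jpos[of x] J0 that by (cases "x = 0") auto
    have Jpc: "continuous_on {0..} (\<lambda>x. J x powr p)" if "p > 0" for p
      by (rule continuous_on_powr'[OF Jc continuous_on_const]) (use Jnn that in auto)
    \<comment> \<open>The majorant \<open>y\<close> of \<open>u\<close>, with derivative \<open>z\<close>. Unlike the derivative of \<open>u\<close>, which is only
      bounded above, \<open>z\<close> determines \<open>J\<close>, and this is what the energy inequality needs.\<close>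
    define z where "z = (\<lambda>x. K * J x powr (1 / m))"
    have zc: "continuous_on {0..} z"
      unfolding z_def by (rule continuous_on_mult_left[OF Jpc]) (use \<open>m > 0\<close> in simp)
    have zpos: "z x > 0" if "x > 0" for x
      unfolding z_def using Jpos[OF that] \<open>K > 0\<close> by simp
    define y where "y = (\<lambda>x. c + integral {0..x} z)"
    have dy: "(y has_real_derivative z x) (at x)" if "x > 0" for x
      unfolding y_def
      using integral_from_derivative_at[OF continuous_on_atLeast_integrable[OF zc] that
            continuous_on_atLeast_at[OF zc that]]
      by (auto intro!: derivative_eq_intros)
    have yc: "continuous_on {0..} y"
      unfolding y_def
      by (intro continuous_intros integral_from_continuous[OF continuous_on_atLeast_integrable[OF zc]])
    have y0: "y 0 = c" by (simp add: y_def)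
    have ygt: "y x > c" if "x > 0" for x
    proof -
      have "y 0 < y x"
        by (rule DERIV_pos_imp_increasing_open[OF that])
           (use dy zpos in blast, rule continuous_on_subset[OF yc], auto)
      then show ?thesis by (simp add: y0)
    qed
    have yge: "y x \<ge> c" if "x \<ge> 0" for x
      using ygt[of x] y0 that by (cases "x = 0") auto
    have wz: "w x \<le> z x" if x: "0 < x" "x \<le> R" for x
    proof -
      have "w x \<le> C * (1 / e) powr (1 / (\<kappa>' * \<theta>)) * x powr ((\<tau> - 1 / \<kappa>) / \<theta> - q) * J x powr (1 / m)"
        using wle[OF x(1)] speed_le_Hoelder[OF h pos \<kappa>(1) \<kappa>\<tau> x(1)]
        by (simp add: h_def J_def m_def e_def \<kappa>'_def gk_def)
      also have "\<dots> \<le> C * (1 / e) powr (1 / (\<kappa>' * \<theta>)) * R powr ((\<tau> - 1 / \<kappa>) / \<theta> - q) * J x powr (1 / m)"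
      proof (intro mult_right_mono mult_left_mono powr_mono2)
        show "0 \<le> (\<tau> - 1 / \<kappa>) / \<theta> - q"
          using \<kappa> \<theta>_pos by (simp add: field_simps)
      qed (use x C_pos in auto)
      also have "\<dots> \<le> z x"
        unfolding z_def K_def by (intro mult_right_mono) auto
      finally show ?thesis .
    qed
    have uy: "u x \<le> y x" if x: "0 \<le> x" "x \<le> R" for x
    proof -
      let ?d = "\<lambda>x. y x - u x"
      have "?d 0 \<le> ?d x"
      proof (rule DERIV_nonneg_imp_increasing_open[where f = ?d])
        fix s assume s: "0 < s" "s < x"
        have "(?d has_real_derivative z s - w s) (at s)"
          using s by (intro DERIV_diff dy du)
        then show "\<exists>t. (?d has_real_derivative t) (at s) \<and> 0 \<le> t"
          using wz[of s] s x by force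
      next
        show "continuous_on {0..x} ?d"
          by (rule continuous_on_subset[of "{0..}"]) (auto intro!: continuous_intros yc u)
      qed (rule x)
      then show ?thesis by (simp add: y0 u0)
    qed
    \<comment> \<open>The energy inequality: the left-hand side has derivative \<open>z * g(u)\<^sup>\<kappa>\<close>, the right-hand side
      \<open>z * g(y)\<^sup>\<kappa>\<close>.\<close>
    have JG: "K * (m / (m + 1)) * J x powr ((m + 1) / m) \<le> G (y x)" if x: "0 \<le> x" "x \<le> R" for x
    proof -
      let ?d = "\<lambda>x. G (y x) - K * (m / (m + 1)) * J x powr ((m + 1) / m)"
      have m1: "(m + 1) / m - 1 = 1 / m" using \<open>m > 0\<close> by (simp add: field_simps)
      have "?d 0 \<le> ?d x"
      proof (rule DERIV_nonneg_imp_increasing_open[where f = ?d])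
        fix s assume s: "0 < s" "s < x"
        have "y s > 0" using ygt[OF s(1)] \<open>c > 0\<close> by simp
        have "(?d has_real_derivative gk (y s) * z s
              - K * (m / (m + 1)) * ((m + 1) / m * J s powr ((m + 1) / m - 1) * gk (u s))) (at s)"
          using s by (intro DERIV_diff DERIV_cmult DERIV_chain2[OF dG[OF \<open>y s > 0\<close>] dy]
              DERIV_chain2[OF has_real_derivative_powr[OF Jpos] dJ])
        moreover have "K * (m / (m + 1)) * ((m + 1) / m * J s powr ((m + 1) / m - 1) * gk (u s)) = z s * gk (u s)"
          unfolding m1 z_def using \<open>m > 0\<close> by simp
        moreover have "z s * gk (u s) \<le> z s * gk (y s)"
          using uy[of s] s x zpos[of s] by (intro mult_left_mono gkmono) auto
        ultimately show "\<exists>t. (?d has_real_derivative t) (at s) \<and> 0 \<le> t"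
          by (metis diff_ge_0_iff_ge mult.commute)
      next
        have "continuous_on {0..} (\<lambda>x. G (y x))"
          by (rule continuous_on_compose2[OF Gc yc]) (use yge in auto)
        then have "continuous_on {0..} ?d"
          by (rule continuous_on_diff[OF _ continuous_on_mult_left[OF Jpc]]) (use \<open>m > 0\<close> in simp)
        then show "continuous_on {0..x} ?d"
          by (rule continuous_on_subset) auto
      qed (rule x)
      moreover have "G (y 0) \<ge> 0" using Gpos[of c] \<open>c > 0\<close> by (simp add: y0)
      ultimately show ?thesis by (simp add: J0)
    qed
    have zf: "f (y x) * z x \<le> K * L" if x: "0 < x" "x \<le> R" for x
    proof -
      have Gy: "G (y x) > 0" using Gpos ygt[OF x(1)] \<open>c > 0\<close> by simp
      have "J x powr ((m + 1) / m) \<le> (m + 1) / (m * K) * G (y x)"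
        using JG[of x] x \<open>m > 0\<close> \<open>K > 0\<close> by (simp add: field_simps)
      then have "(J x powr ((m + 1) / m)) powr (1 / (m + 1)) \<le> ((m + 1) / (m * K) * G (y x)) powr (1 / (m + 1))"
        using \<open>m > 0\<close> by (intro powr_mono2) auto
      moreover have "((m + 1) / (m * K) * G (y x)) powr (1 / (m + 1)) = L * G (y x) powr (1 / (m + 1))"
        unfolding L_def by (rule powr_mult)
      moreover have "(J x powr ((m + 1) / m)) powr (1 / (m + 1)) = J x powr (1 / m)"
        using \<open>m > 0\<close> by (simp add: powr_powr)
      ultimately have "J x powr (1 / m) \<le> L * G (y x) powr (1 / (m + 1))" by simp
      then show ?thesis
        using Gy \<open>K > 0\<close> by (simp add: z_def f_def powr_minus field_simps)
    qed
    \<comment> \<open>Separation of variables in \<open>y' \<le> K * L * G(y)\<^bsup>1/(m+1)\<^esup>\<close>.\<close>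
    have Fy: "F (y r) \<le> K * L * r"
    proof -
      let ?d = "\<lambda>x. K * L * x - F (y x)"
      have "?d 0 \<le> ?d r"
      proof (rule DERIV_nonneg_imp_increasing_open[where f = ?d])
        fix s assume s: "0 < s" "s < r"
        have "(?d has_real_derivative K * L * 1 - f (y s) * z s) (at s)"
          using s by (intro DERIV_diff DERIV_cmult DERIV_ident DERIV_chain2[OF dF[OF ygt] dy])
        then show "\<exists>t. (?d has_real_derivative t) (at s) \<and> 0 \<le> t"
          using zf[of s] s r by force
      next
        have "continuous_on {0..} (\<lambda>x. F (y x))"
          by (rule continuous_on_compose2[OF Fc yc]) (use yge in auto)
        then have "continuous_on {0..} ?d"
          by (intro continuous_intros)
        then show "continuous_on {0..r} ?d"
          by (rule continuous_on_subset) auto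
      qed (rule r)
      then show ?thesis by (simp add: y0 F_def)
    qed
    also have "\<dots> \<le> K * L * R"
      using r \<open>K > 0\<close> \<open>L > 0\<close> by (intro mult_left_mono) auto
    also have "\<dots> < F T" by (rule T)
    finally have "F (y r) < F T" .
    have "y r < T"
    proof (rule ccontr)
      assume "\<not> y r < T"
      then have "integral {c..y r} f - integral {c..T} f = integral {T..y r} f"
        using T by (intro integral_difference fc) auto
      moreover have "integral {T..y r} f \<ge> 0"
        by (rule integral_nonneg[OF integrable_continuous_real[OF continuous_on_subset[OF fc]]])
           (use T in \<open>auto simp: f_def\<close>)
      ultimately show False
        using \<open>F (y r) < F T\<close> by (simp add: F_def)
    qed
    with uy[OF r] show ?thesis by simp
  qed
  then show thesis by (rule that)
qed

section \<open>Monotone iteration\<close>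

primrec picard :: "(real \<Rightarrow> real) \<Rightarrow> real \<Rightarrow> nat \<Rightarrow> real \<Rightarrow> real" where
  "picard g a 0 = (\<lambda>_. a)"
| "picard g a (Suc n) = (\<lambda>r. a + integral {0..r} (speed (\<lambda>s. g (picard g a n s))))"

lemma picard_at_0 [simp]: "picard g a n 0 = a"
  by (cases n) auto

lemma picard_continuous:
  assumes g: "continuous_on UNIV g" "\<And>x. g x > 0"
  shows "continuous_on {0..} (picard g a n)"
proof (induction n)
  case (Suc n)
  have "continuous_on {0..} (\<lambda>s. g (picard g a n s))"
    by (rule continuous_on_compose2[OF g(1) Suc]) auto
  then show ?case
    by (auto intro!: continuous_intros integral_from_continuous continuous_on_atLeast_integrable
        speed_continuous g)
qed simp

lemma picard_composite_continuous:
  assumes g: "continuous_on UNIV g" "\<And>x. g x > 0"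
  shows "continuous_on {0..} (\<lambda>s. g (picard g a n s))"
  by (rule continuous_on_compose2[OF g(1) picard_continuous[OF g]]) auto

lemma picard_speed_integrable:
  assumes g: "continuous_on UNIV g" "\<And>x. g x > 0"
  shows "speed (\<lambda>s. g (picard g a n s)) integrable_on {0..b}"
  by (intro continuous_on_atLeast_integrable speed_continuous picard_composite_continuous g)

text \<open>The integral operator is monotone, and the first step lies above the constant it starts from.\<close>

lemma picard_increasing:
  assumes g: "continuous_on UNIV g" "\<And>x. g x > 0" "mono g" and "0 \<le> r"
  shows "picard g a n r \<le> picard g a (Suc n) r"
  using \<open>0 \<le> r\<close>
proof (induction n arbitrary: r)
  case 0
  have "0 \<le> integral {0..r} (speed (\<lambda>s. g a))"
  proof (rule integral_nonneg)
    show "speed (\<lambda>s. g a) integrable_on {0..r}"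
      using picard_speed_integrable[OF g(1,2), of a 0] by simp
    fix s assume "s \<in> {0..r}"
    then show "0 \<le> speed (\<lambda>s. g a) s"
      using speed_pos[of "\<lambda>_. g a" s] g(2) by (cases "s = 0") auto
  qed
  then show ?case by simp
next
  case (Suc n)
  have "integral {0..r} (speed (\<lambda>s. g (picard g a n s)))
      \<le> integral {0..r} (speed (\<lambda>s. g (picard g a (Suc n) s)))"
    by (intro integral_le picard_speed_integrable speed_mono picard_composite_continuous g monoD[OF g(3)] Suc.IH)
       auto
  then show ?case by simp
qed

lemma picard_derivative:
  assumes g: "continuous_on UNIV g" "\<And>x. g x > 0" and "r > 0"
  shows "(picard g a (Suc n) has_real_derivative speed (\<lambda>s. g (picard g a n s)) r) (at r)"
proof -
  have "continuous_on {0..} (speed (\<lambda>s. g (picard g a n s)))"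
    by (intro speed_continuous picard_composite_continuous g)
  from integral_from_derivative_at[OF picard_speed_integrable[OF g] \<open>r > 0\<close>
      continuous_on_atLeast_at[OF this \<open>r > 0\<close>]]
  show ?thesis by (auto intro!: derivative_eq_intros)
qed

text \<open>The iterates increase to a limit, and dominated convergence passes to the limit in both integrals: the
  inner one inside \<open>speed\<close> and the outer one. On \<open>[0,r]\<close> the constant \<open>g B\<close> majorizes all \<open>g \<circ> picard\<close>.
  Continuity of the limit follows from the equation afterwards.\<close>

lemma integral_solution_exists:
  assumes g: "continuous_on UNIV g" "\<And>x. g x > 0" "mono g"
    and bound: "\<And>R. 0 < R \<Longrightarrow> \<exists>B. \<forall>n. \<forall>r\<in>{0..R}. picard g a n r \<le> B"
  obtains v where "continuous_on {0..} v"
    "\<And>r. 0 \<le> r \<Longrightarrow> v r = a + integral {0..r} (speed (\<lambda>s. g (v s)))"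
proof -
  define v where "v = (\<lambda>r. lim (\<lambda>n. picard g a n r))"
  have inc: "incseq (\<lambda>n. picard g a n r)" if "0 \<le> r" for r
    by (rule incseq_SucI) (rule picard_increasing[OF g that])
  have lim: "(\<lambda>n. picard g a n r) \<longlonglongrightarrow> v r" if "0 \<le> r" for r
  proof -
    obtain B where "\<forall>n. \<forall>s\<in>{0..r+1}. picard g a n s \<le> B"
      using bound[of "r + 1"] \<open>0 \<le> r\<close> by auto
    then have "\<forall>n. picard g a n r \<le> B" using that by simp
    then obtain L where "(\<lambda>n. picard g a n r) \<longlonglongrightarrow> L"
      using incseq_convergent[OF inc[OF \<open>0 \<le> r\<close>], of B] by blast
    then show ?thesis unfolding v_def by (simp add: limI)
  qed
  have speed_lim: "(\<lambda>n. speed (\<lambda>s. g (picard g a n s)) r) \<longlonglongrightarrow> speed (\<lambda>s. g (v s)) r"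
    and int: "speed (\<lambda>s. g (v s)) integrable_on {0..r}"
    and int_lim: "(\<lambda>n. integral {0..r} (speed (\<lambda>s. g (picard g a n s))))
        \<longlonglongrightarrow> integral {0..r} (speed (\<lambda>s. g (v s)))" if "0 < r" for r
  proof -
    obtain B where B: "\<And>n s. s \<in> {0..r} \<Longrightarrow> picard g a n s \<le> B"
      using bound[OF \<open>0 < r\<close>] by blast
    have gB: "g (picard g a n s) \<le> g B" if "0 \<le> s" "s \<le> r" for n s
      by (rule monoD[OF g(3) B]) (use that in auto)
    have pc: "continuous_on {0..} (\<lambda>s. g (picard g a n s))" for n
      by (rule picard_composite_continuous[OF g(1,2)])
    have sl: "(\<lambda>n. speed (\<lambda>s. g (picard g a n s)) x) \<longlonglongrightarrow> speed (\<lambda>s. g (v s)) x"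
      if x: "0 \<le> x" "x \<le> r" for x
    proof -
      have "(\<lambda>n. moment (\<lambda>s. g (picard g a n s)) x) \<longlonglongrightarrow> moment (\<lambda>s. g (v s)) x"
        unfolding moment_def
      proof (rule dominated_convergence(2))
        show "(\<lambda>s. s powr (\<tau> - 1) * g (picard g a n s)) integrable_on {0..x}" for n
          by (rule weighted_integrable[OF pc])
        show "(\<lambda>s. s powr (\<tau> - 1) * g B) integrable_on {0..x}"
          by (rule weighted_integrable) simp
        fix s assume s: "s \<in> {0..x}"
        show "norm (s powr (\<tau> - 1) * g (picard g a n s)) \<le> s powr (\<tau> - 1) * g B" for n
          using gB[of s n] s x g(2)[of "picard g a n s"] by (auto simp: abs_mult intro: mult_left_mono)
        have "isCont g (v s)"
          using g(1) by (simp add: continuous_on_eq_continuous_at)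
        then show "(\<lambda>n. s powr (\<tau> - 1) * g (picard g a n s)) \<longlonglongrightarrow> s powr (\<tau> - 1) * g (v s)"
          using s by (intro tendsto_intros isCont_tendsto_compose[OF _ lim]) auto
      qed
      then show ?thesis
        unfolding speed_def using \<theta>_pos moment_nonneg[OF pc g(2)]
        by (intro tendsto_intros tendsto_powr') auto
    qed
    then show "(\<lambda>n. speed (\<lambda>s. g (picard g a n s)) r) \<longlonglongrightarrow> speed (\<lambda>s. g (v s)) r"
      using that by simp
    have dom: "norm (speed (\<lambda>s. g (picard g a n s)) x) \<le> speed (\<lambda>s. g B) x" if "x \<in> {0..r}" for n x
    proof -
      have "speed (\<lambda>s. g (picard g a n s)) x \<le> speed (\<lambda>s. g B) x"
        using that gB by (intro speed_mono pc g(2)) auto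
      moreover have "0 \<le> speed (\<lambda>s. g (picard g a n s)) x"
        unfolding speed_def using C_pos by simp
      ultimately show ?thesis by simp
    qed
    have intB: "speed (\<lambda>s. g B) integrable_on {0..r}"
      by (intro continuous_on_atLeast_integrable speed_continuous) (auto simp: g)
    show "speed (\<lambda>s. g (v s)) integrable_on {0..r}"
      by (rule dominated_convergence(1)[OF picard_speed_integrable[OF g(1,2)] intB dom sl]) auto
    show "(\<lambda>n. integral {0..r} (speed (\<lambda>s. g (picard g a n s))))
        \<longlonglongrightarrow> integral {0..r} (speed (\<lambda>s. g (v s)))"
      by (rule dominated_convergence(2)[OF picard_speed_integrable[OF g(1,2)] intB dom sl]) auto
  qed
  have eq: "v r = a + integral {0..r} (speed (\<lambda>s. g (v s)))" if "0 \<le> r" for r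
  proof (cases "r = 0")
    case True
    then show ?thesis by (simp add: v_def)
  next
    case False
    then have "(\<lambda>n. picard g a (Suc n) r) \<longlonglongrightarrow> a + integral {0..r} (speed (\<lambda>s. g (v s)))"
      using that by (auto intro!: tendsto_intros int_lim)
    moreover have "(\<lambda>n. picard g a (Suc n) r) \<longlonglongrightarrow> v r"
      using LIMSEQ_Suc[OF lim[OF that]] .
    ultimately show ?thesis by (rule LIMSEQ_unique[rotated])
  qed
  have "speed (\<lambda>s. g (v s)) integrable_on {0..b}" for b
  proof (cases "b > 0")
    case False
    then show ?thesis by (cases "b = 0") (use integrable_on_refl in auto)
  qed (rule int)
  then have "continuous_on {0..} (\<lambda>r. a + integral {0..r} (speed (\<lambda>s. g (v s))))"
    by (intro continuous_intros integral_from_continuous)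
  then have "continuous_on {0..} v"
    by (rule continuous_on_eq) (rule eq[symmetric], simp)
  then show thesis using eq by (rule that)
qed

text \<open>Each iterate lies below the next one, which is a subsolution since its derivative is the speed belonging
  to a smaller function. So \<open>a_priori_bound\<close> applies to all iterates at once.\<close>

lemma integral_condition_sufficient:
  assumes g: "continuous_on UNIV g" "\<And>x. g x > 0" "mono g"
    and \<kappa>: "\<kappa> > 1" "1 < \<kappa> * (\<tau> - \<theta> * q)" and "c > 0"
    and inf: "(\<integral>\<^sup>+ t\<in>{c..}. ennreal ((integral {0..t} (\<lambda>s. g s powr \<kappa>)) powr (- (1 / (\<kappa> * \<theta> + 1)))) \<partial>lborel) = \<infinity>"
  obtains v where "convex_solution g q \<theta> C \<tau> c v" "regularity g q \<theta> C \<tau> c v"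
proof -
  let ?f = "\<lambda>t. integral {0..t} (\<lambda>s. g s powr \<kappa>) powr (- (1 / (\<kappa> * \<theta> + 1)))"
  have gkc: "continuous_on {0..} (\<lambda>s. g s powr \<kappa>)"
    using continuous_on_subset[OF g(1)]
    by (intro continuous_intros) (auto simp: less_imp_neq[OF g(2), symmetric])
  have "integral {0..t} (\<lambda>s. g s powr \<kappa>) > 0" if "t \<ge> c" for t
  proof -
    have "0 < t * g 0 powr \<kappa>" using that \<open>c > 0\<close> g(2)[of 0] by simp
    also have "\<dots> \<le> integral {0..t} (\<lambda>s. g s powr \<kappa>)"
      using \<kappa> that \<open>c > 0\<close> less_imp_le[OF g(2)]
      by (intro integral_ge_initial_value continuous_on_atLeast_integrable[OF gkc])
         (auto intro: powr_mono2 monoD[OF g(3)])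
    finally show ?thesis .
  qed
  then have fc: "continuous_on {c..} ?f"
    using \<open>c > 0\<close>
    by (intro continuous_intros
          continuous_on_subset[OF integral_from_continuous[OF continuous_on_atLeast_integrable[OF gkc]]])
       (auto simp: less_imp_neq[symmetric])
  have unb: "\<exists>T\<ge>c. B < integral {c..T} ?f" for B
    using inf nn_integral_atLeast_eq_infinity_iff[OF fc] by auto
  have bound: "\<exists>B. \<forall>n. \<forall>r\<in>{0..R}. picard g c n r \<le> B" if "R > 0" for R
  proof -
    obtain B where B: "\<And>u w r. continuous_on {0..} u \<Longrightarrow> u 0 = c \<Longrightarrow>
      (\<And>r. 0 < r \<Longrightarrow> (u has_real_derivative w r) (at r)) \<Longrightarrow>
      (\<And>r. 0 < r \<Longrightarrow> w r \<le> speed (\<lambda>s. g (u s)) r) \<Longrightarrow> 0 \<le> r \<Longrightarrow> r \<le> R \<Longrightarrow> u r \<le> B"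
      using a_priori_bound[OF g \<kappa> \<open>c > 0\<close> \<open>R > 0\<close> unb] by blast
    have "picard g c n r \<le> B" if r: "r \<in> {0..R}" for n r
    proof -
      have "picard g c n r \<le> picard g c (Suc n) r"
        using r by (intro picard_increasing[OF g]) auto
      also have "\<dots> \<le> B"
      proof (rule B[where u = "picard g c (Suc n)" and r = r and w = "speed (\<lambda>s. g (picard g c n s))"])
        fix s :: real assume "0 < s"
        show "(picard g c (Suc n) has_real_derivative speed (\<lambda>s. g (picard g c n s)) s) (at s)"
          by (rule picard_derivative[OF g(1,2) \<open>0 < s\<close>])
        show "speed (\<lambda>s. g (picard g c n s)) s \<le> speed (\<lambda>s. g (picard g c (Suc n) s)) s"
          by (intro speed_mono picard_composite_continuous g monoD[OF g(3)] picard_increasing[OF g]) auto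
      qed (use r picard_continuous[OF g(1,2)] picard_at_0 in \<open>auto simp del: picard.simps\<close>)
      finally show ?thesis .
    qed
    then show ?thesis by blast
  qed
  obtain v where "continuous_on {0..} v"
    "\<And>r. 0 \<le> r \<Longrightarrow> v r = c + integral {0..r} (speed (\<lambda>s. g (v s)))"
    using integral_solution_exists[OF g bound] by blast
  from that[OF regularity_of_integral_solution[OF g this]] show thesis .
qed

end

theorem theorem1p3:
  fixes g :: "real \<Rightarrow> real" and q \<theta> C \<tau> c :: real
  assumes "\<And>x. g x > 0" and "mono g" and "continuous_on UNIV g"
    and "q \<ge> 0" and "\<theta> > 0" and "C > 0"
    and "\<theta> * q < \<tau>" and "\<tau> < \<theta> * q + 1"
    and "c > 0"
  shows
    "((\<exists>\<epsilon> \<kappa>. 0 < \<epsilon> \<and> \<epsilon> < \<tau> - \<theta> * q \<and> \<kappa> = (1 - \<epsilon>) / (\<tau> - \<theta> * q - \<epsilon>) \<and>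
         (\<integral>\<^sup>+ t\<in>{c..}. ennreal ((integral {0..t} (\<lambda>s. g s powr \<kappa>)) powr (- (1 / (\<kappa> * \<theta> + 1)))) \<partial>lborel) = \<infinity>)
       \<longrightarrow> (\<exists>a v. convex_solution g q \<theta> C \<tau> a v \<and> regularity g q \<theta> C \<tau> a v))
     \<and>
     ((\<exists>a v. convex_solution g q \<theta> C \<tau> a v \<and> regularity g q \<theta> C \<tau> a v)
       \<longrightarrow> (\<integral>\<^sup>+ t\<in>{c..}. ennreal ((integral {0..t} g) powr (- (1 / (\<theta> + 1)))) \<partial>lborel) = \<infinity>)"
proof -
  interpret radial_equation q \<theta> C \<tau>
    by unfold_locales (use assms in auto)
  note g = assms(3,1,2)
  show ?thesis
  proof (intro conjI impI; elim exE conjE)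
    fix \<epsilon> \<kappa>
    assume \<epsilon>: "0 < \<epsilon>" "\<epsilon> < \<tau> - \<theta> * q" and \<kappa>: "\<kappa> = (1 - \<epsilon>) / (\<tau> - \<theta> * q - \<epsilon>)"
      and inf: "(\<integral>\<^sup>+ t\<in>{c..}. ennreal ((integral {0..t} (\<lambda>s. g s powr \<kappa>)) powr (- (1 / (\<kappa> * \<theta> + 1)))) \<partial>lborel) = \<infinity>"
    \<comment> \<open>Since \<open>\<epsilon> < d < 1\<close>, the numerator \<open>1 - \<epsilon>\<close> exceeds the denominator \<open>d - \<epsilon>\<close>, and \<open>\<kappa> * d > 1\<close>
      amounts to \<open>\<epsilon> * d < \<epsilon>\<close>.\<close>
    define d where "d = \<tau> - \<theta> * q"
    have d: "\<epsilon> < d" "d < 1" "\<kappa> = (1 - \<epsilon>) / (d - \<epsilon>)" using \<epsilon> \<kappa> assms by (auto simp: d_def)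
    have "\<kappa> > 1" unfolding d(3) using d(1,2) by (simp add: less_divide_eq)
    moreover have "\<epsilon> * d < \<epsilon>" using d \<epsilon> by simp
    then have "1 < \<kappa> * d" unfolding d(3) using d(1) by (simp add: less_divide_eq algebra_simps)
    ultimately show "\<exists>a v. convex_solution g q \<theta> C \<tau> a v \<and> regularity g q \<theta> C \<tau> a v"
      using integral_condition_sufficient[OF g _ _ \<open>c > 0\<close> inf] unfolding d_def by metis
  next
    fix a v
    assume sol: "convex_solution g q \<theta> C \<tau> a v"
    have "continuous_on {0..} v"
      using sol by (simp add: convex_solution_def differentiable_imp_continuous_on)
    moreover have "(v has_real_derivative speed (\<lambda>s. g (v s)) r) (at r)" if "r > 0" for r
      using sol that by (simp add: convex_solution_def solves_P_def speed_def moment_def)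
    ultimately show "(\<integral>\<^sup>+ t\<in>{c..}. ennreal ((integral {0..t} g) powr (- (1 / (\<theta> + 1)))) \<partial>lborel) = \<infinity>"
      by (intro integral_condition_necessary[OF g _ _ \<open>c > 0\<close>])
  qed
qed

end
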